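(* Let $k$ and $s$ be fixed integers with $0\le s\le k$, and let $G_s$ be the Gram matrix of the partition algebra. For $0\le r\le k-s$ and $0\le t\le\min\{s,r\}$ put $$X_{\min\{s,r\}-t}=(-1)^t\,t!\prod_{m=t}^{r-1}[x-(s+m)]$$ (these quantities depend on $r$). (i) The set of all distinct eigenvalues of the Gram matrix $G_s$ (with entries $\{X_0,X_1,\dots,X_{\min\{s,r\}}\}$) is given by $$\sum_{t=0}^{\min\{s,r\}}\left[\sum_{j=0}^{l}(-1)^j\binom{l}{j}\binom{s-l}{t-j}\binom{r-l}{t-j}\right]X_{\min\{s,r\}-t}$$ for all $0\le l\le\min\{s,r\}$ and $0\le r\le k-s$. (ii) The eigenvalues of the Gram matrix $G_s$ are products of linear factors $x-n$ with $n$ an integer, given by $$\sum_{t=0}^{\min\{s,r\}}\left[\sum_{j=0}^{l}(-1)^j\binom{l}{j}\binom{s-l}{t-j}\binom{r-l}{t-j}\right]X_{\min\{s,r\}-t}=\prod_{i=0}^{l-1}[x-(s-1+i)]\prod_{j=0}^{\min\{s,r\}-l-1}[x-(2s+j)]$$ for $0\le l\le\min\{s,r\}$.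
   Context: Here $x$ is an indeterminate over $\mathbb{C}$; $\binom{a}{b}=0$ for $b<0$ or $b>a$; empty products are $1$. Gram matrix of the partition algebra. For $0\le r\le k-s$ let $\mathbb{J}_s^r$ be the set of $k$-partition diagrams (set partitions of $\{1,\dots,k\}\cup\{1',\dots,k'\}$ drawn in two rows) of the following form: the top row carries a set partition $\pi$ of $\{1,\dots,k\}$ into $s+r$ blocks, the bottom row carries the same partition, and exactly $s$ chosen blocks of $\pi$ (the through classes) are joined to their copies in the bottom row; the other $r$ blocks are called horizontal edges. So an element of $\mathbb{J}_s^r$ is a pair $(\pi,M)$ where $\pi$ is a set partition of $\{1,\dots,k\}$ with $s+r$ blocks and $M$ is a set of $s$ blocks of $\pi$. Put $J_s^k=\bigcup_{0\le r\le k-s}\mathbb{J}_s^r$. The product of two diagrams is formed by placing the first above the second and identifying the bottom row of the first with the top row of the second; the propagating number of the resulting diagram is its number of blocks meeting both the top and the bottom row. $G_s$ is the square matrix with rows and columns indexed by $J_s^k$, whose $(i,j)$ entry is $x^{l}$ if the product of the $i$-th and $j$-th diagrams has propagating number $s$, where $l$ is the number of connected components lying entirely in the middle row of the product, and is $0$ if the propagating number is less than $s$. Equivalently, for $(\pi,M),(\pi',M')$ let $\pi\vee\pi'$ be the join of the two partitions: the propagating number is the number of blocks of $\pi\vee\pi'$ that contain a block of $M$ and a block of $M'$, and $l$ is the number of blocks of $\pi\vee\pi'$ that contain no block of $M$ or $M'$. The phrase "with entries $\{X_0,\dots\}$" refers to the block diagonal matrix $G'_s=\bigoplus_{0\le r\le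 k-s}A'_{r,r}$ to which the paper reduces $G_s$ by column operations and corresponding row operations (and which it calls similar to $G_s$): the entry of $A'_{r,r}$ at $(\pi,M),(\pi',M')\in\mathbb{J}_s^r$ is $X_{\min\{s,r\}-t}$ if $\pi=\pi'$ and $|M\setminus M'|=t$, and $0$ otherwise.
   Formalization: The eigenvalues are those of the block diagonal matrix with entries X_i, which is shown congruent (not similar) to G_s; in (i) the case r = s = 0 < k is left out, its block being empty; in (ii) the upper limit min{s,r}-l-1 is corrected to r-l-1 when r > s. *)

theory Defs
  imports
    "HOL-Library.Disjoint_Sets"
    "HOL-Computational_Algebra.Fraction_Field"
    "HOL-Algebra.Algebraic_Closure_Type"
    "Jordan_Normal_Form.Spectral_Radius"
begin

section \<open>Partition diagrams\<close>

text \<open>A pair \<open>(\<pi>, M)\<close> is a set partition of \<open>{1..k}\<close> with \<open>s + r\<close> blocks together with its \<open>s\<close>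
  through classes.\<close>

type_synonym sdiagram = "nat set set \<times> nat set set"

definition JJ :: "nat \<Rightarrow> nat \<Rightarrow> nat \<Rightarrow> sdiagram set" where
  "JJ k s r = {(\<pi>, M). partition_on {1..k} \<pi> \<and> card \<pi> = s + r \<and> M \<subseteq> \<pi> \<and> card M = s}"

definition J :: "nat \<Rightarrow> nat \<Rightarrow> sdiagram set" where
  "J k s = (\<Union>r\<in>{0..k - s}. JJ k s r)"

text \<open>A vertex is a pair (row, point). A single diagram lives on the rows 0 (top) and 1 (bottom);
  a product of two diagrams lives on the rows 0 (top), 1 (middle) and 2 (bottom).\<close>

type_synonym vertex = "nat \<times> nat"

definition diagram :: "sdiagram \<Rightarrow> vertex set set" where
  "diagram d = (case d of (\<pi>, M) \<Rightarrow>
     (\<lambda>B. {0, 1} \<times> B) ` M \<union> (\<lambda>B. {0} \<times> B) ` (\<pi> - M) \<union> (\<lambda>B. {1} \<times> B) ` (\<pi> - M))"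

definition shift_down :: "vertex set set \<Rightarrow> vertex set set" where
  "shift_down D = (\<lambda>B. (\<lambda>(row, i). (Suc row, i)) ` B) ` D"

text \<open>Connected components, middle row included, of the graph obtained by placing the first diagram
  above the second one.\<close>

definition components :: "nat \<Rightarrow> vertex set set \<Rightarrow> vertex set set \<Rightarrow> vertex set set" where
  "components k D E = ({0, 1, 2} \<times> {1..k}) // (\<Union>B \<in> D \<union> shift_down E. B \<times> B)\<^sup>+"

text \<open>The blocks of the product diagram are the components with the middle row deleted, so a block
  meeting top and bottom row is the same thing as a component meeting the rows 0 and 2.\<close>

definition propagating_number :: "nat \<Rightarrow> vertex set set \<Rightarrow> vertex set set \<Rightarrow> nat" where
  "propagating_number k D E =
     card {C \<in> components k D E. (\<exists>i. (0, i) \<in> C) \<and> (\<exists>i. (2, i) \<in> C)}"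

definition middle_components :: "nat \<Rightarrow> vertex set set \<Rightarrow> vertex set set \<Rightarrow> nat" where
  "middle_components k D E = card {C \<in> components k D E. C \<subseteq> {1} \<times> {1..k}}"

section \<open>The Gram matrix and its block diagonal reduction\<close>

text \<open>The indeterminate \<open>x\<close> over the complex numbers.\<close>

abbreviation X_var :: "complex poly" where
  "X_var \<equiv> [:0, 1:]"

definition gram_entry :: "nat \<Rightarrow> nat \<Rightarrow> sdiagram \<Rightarrow> sdiagram \<Rightarrow> complex poly" where
  "gram_entry k s d e =
     (if propagating_number k (diagram d) (diagram e) = s
      then X_var ^ middle_components k (diagram d) (diagram e) else 0)"

text \<open>The list \<open>js\<close> is an enumeration of the index set \<open>J k s\<close>.\<close>

definition gram_matrix :: "nat \<Rightarrow> nat \<Rightarrow> sdiagram list \<Rightarrow> complex poly mat" where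
  "gram_matrix k s js = mat (length js) (length js) (\<lambda>(i, j). gram_entry k s (js ! i) (js ! j))"

text \<open>\<open>gram_X s r i\<close> is \<open>X\<^sub>i\<close>, where \<open>i = min s r - t\<close>.\<close>

definition gram_X :: "nat \<Rightarrow> nat \<Rightarrow> nat \<Rightarrow> complex poly" where
  "gram_X s r i = (let t = min s r - i in
     (-1) ^ t * of_nat (fact t) * (\<Prod>m\<in>{t..<r}. X_var - of_nat (s + m)))"

text \<open>The entries of the direct sum of the blocks \<open>A'\<^sub>r\<^sub>,\<^sub>r\<close>. Diagrams from different \<open>JJ k s r\<close>
  have different partitions, so the entries outside the diagonal blocks are 0.\<close>

definition gram_entry' :: "nat \<Rightarrow> sdiagram \<Rightarrow> sdiagram \<Rightarrow> complex poly" where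
  "gram_entry' s d e = (case (d, e) of ((\<pi>, M), (\<pi>', M')) \<Rightarrow>
     (if \<pi> = \<pi>' then (let r = card \<pi> - s in gram_X s r (min s r - card (M - M'))) else 0))"

definition gram_matrix' :: "nat \<Rightarrow> sdiagram list \<Rightarrow> complex poly mat" where
  "gram_matrix' s js = mat (length js) (length js) (\<lambda>(i, j). gram_entry' s (js ! i) (js ! j))"

section \<open>Eigenvalues\<close>

text \<open>The library's \<open>choose\<close> has a natural number below; here the lower entry \<open>t - j\<close> may be
  negative, in which case the coefficient is 0.\<close>

definition binom :: "nat \<Rightarrow> int \<Rightarrow> int" where
  "binom a b = (if b < 0 then 0 else int (a choose nat b))"

definition gram_eig :: "nat \<Rightarrow> nat \<Rightarrow> nat \<Rightarrow> complex poly" where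
  "gram_eig s r l = (\<Sum>t = 0..min s r.
     of_int (\<Sum>j = 0..l. (-1) ^ j * binom l (int j) * binom (s - l) (int t - int j)
                                  * binom (r - l) (int t - int j))
     * gram_X s r (min s r - t))"

text \<open>Eigenvalues of a matrix over \<open>\<complex>[x]\<close> are taken in an algebraic closure of \<open>\<complex>(x)\<close>.\<close>

definition emb :: "complex poly \<Rightarrow> complex poly fract alg_closure" where
  "emb p = to_ac (Fraction_Field.Fract p 1)"

end

theory Submission
  imports Defs
begin

text \<open>Let \<open>Z\<close> be the matrix with entry 1 at \<open>((\<rho>, N), (\<pi>, M))\<close> if \<open>\<rho>\<close> coarsens \<open>\<pi>\<close> and \<open>N\<close>, the set of blocks
  of \<open>\<rho>\<close> containing a block of \<open>M\<close>, still has \<open>s\<close> elements. It is unitriangular with respect to the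
  number of blocks, and \<open>G = Z\<^sup>T G' Z\<close>: both partitions of a pair may be replaced by their join, and the
  sum over its coarsenings is evaluated by removing one point at a time. A point outside both sets of
  through classes contributes a factor \<open>x\<close>; a point in exactly one of them makes the sum vanish.

  Each block of \<open>G'\<close> is a combination of the relations of the Johnson scheme of \<open>s\<close>-subsets of an
  \<open>(s + r)\<close>-set. Products of \<open>l\<close> differences \<open>[a \<in> M] - [b \<in> M]\<close> over disjoint pairs are eigenvectors.
  Conversely, for an eigenvector \<open>v\<close> take a smallest \<open>L\<close> such that the sum of \<open>v\<close> over all \<open>M \<supseteq> L\<close> is not 0;
  comparing these sums for \<open>v\<close> and its image determines the eigenvalue from \<open>card L\<close> alone. Splitting off
  one pair lowers \<open>l\<close>, \<open>s\<close>, \<open>r\<close> by one and replaces the weight \<open>w\<close> by \<open>w t - w (t + 1)\<close>. For the weights of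
  \<open>G'\<close> this difference is a linear factor times the weight for \<open>x - 1\<close>, whence the product formula.\<close>

section \<open>Eigenvalues of the Johnson scheme\<close>

text \<open>\<open>gram_matrix\<close> and \<open>gram_matrix'\<close> are congruent, not conjugate:
  for k = 2, s = 0 their traces are x + x^2 and x^2. The eigenvalues are therefore those of
  \<open>gram_matrix'\<close>; for \<open>gram_matrix\<close> the congruence is proved, by a matrix
  that is invertible over the polynomial ring itself because \<open>det Z = 1\<close>. An eigenvalue
  has degree r in x, so its second product has r - l factors; this is min s r - l only for r \<le>
  s. A pair (r, l) counts only if some diagram has r horizontal edges: for s = r = 0 and k > 0 there
  is none, and the value 1 of the formula would be spurious. The alternating binomial sum in
  \<open>gram_eig\<close> is never evaluated directly. It is identified with the recursion
  \<open>johnson_eig\<close>, which is what splitting off a pair produces; product formula,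
  eigenvectors and completeness of the spectrum all meet there. The weights are studied with y = x -
  s as a free ring element, because the inductions replace y by y - 1.\<close>

fun johnson_eig :: "nat \<Rightarrow> nat \<Rightarrow> nat \<Rightarrow> (nat \<Rightarrow> 'a::comm_ring_1) \<Rightarrow> 'a" where
  "johnson_eig 0 s r w = (\<Sum>u\<le>s. of_nat ((s choose u) * (r choose u)) * w u)"
| "johnson_eig (Suc l) s r w = johnson_eig l (s - 1) (r - 1) (\<lambda>t. w t - w (Suc t))"

text \<open>Each unfolding applies the difference w t - w (t + 1) once, so l of them give the
  alternating binomial sum. The product of two binomials counts the sets at distance u from a given
  (s - l)-subset of a set with (s - l) + (r - l) points.\<close>

lemma johnson_eig_closed:
  assumes "l \<le> s" "l \<le> r"
  shows "johnson_eig l s r w =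
    (\<Sum>u\<le>s - l. of_nat (((s - l) choose u) * ((r - l) choose u)) *
       (\<Sum>j\<le>l. (-1) ^ j * of_nat (l choose j) * w (u + j)))"
  using assms
proof (induction l arbitrary: s r w)
  case 0
  then show ?case by simp
next
  case (Suc l)
  \<comment> \<open>One further difference turns row l of the alternating binomials into row l +
    1.\<close>
  have pascal: "(\<Sum>j\<le>l. (-1) ^ j * of_nat (l choose j) * (w (u + j) - w (Suc (u + j)))) =
    (\<Sum>j\<le>Suc l. (-1) ^ j * of_nat (Suc l choose j) * w (u + j))" (is "?L = ?R") for u
  proof -
    have "?R = w u + (\<Sum>j\<le>l. (-1) ^ Suc j * of_nat (Suc l choose Suc j) * w (u + Suc j))"
      by (simp only: sum.atMost_Suc_shift) simp
    also have "\<dots> = (w u + (\<Sum>j\<le>l. (-1) ^ Suc j * of_nat (l choose Suc j) * w (u + Suc j)))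
        - (\<Sum>j\<le>l. (-1) ^ j * of_nat (l choose j) * w (Suc (u + j)))"
      by (simp add: algebra_simps sum.distrib sum_negf sum_subtractf)
    also have "w u + (\<Sum>j\<le>l. (-1) ^ Suc j * of_nat (l choose Suc j) * w (u + Suc j)) =
        (\<Sum>j\<le>Suc l. (-1) ^ j * of_nat (l choose j) * w (u + j))"
      by (simp only: sum.atMost_Suc_shift) simp
    also have "\<dots> = (\<Sum>j\<le>l. (-1) ^ j * of_nat (l choose j) * w (u + j))"
      by (simp add: binomial_eq_0)
    finally show ?thesis
      by (simp add: right_diff_distrib sum_subtractf)
  qed
  have "johnson_eig (Suc l) s r w = (\<Sum>u\<le>s - 1 - l.
      of_nat (((s - 1 - l) choose u) * ((r - 1 - l) choose u)) *
      (\<Sum>j\<le>l. (-1) ^ j * of_nat (l choose j) * (w (u + j) - w (Suc (u + j)))))"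
    using Suc by simp
  then show ?case
    unfolding pascal by simp
qed

text \<open>With y = x - s this is the entry X of \<open>gram_X\<close> at distance t, since x - (s
  + m) = y - m. In this form s enters only through y.\<close>

definition gram_weight :: "'a::comm_ring_1 \<Rightarrow> nat \<Rightarrow> nat \<Rightarrow> 'a" where
  "gram_weight y r t = (-1) ^ t * of_nat (fact t) * (\<Prod>m\<in>{t..<r}. y - of_nat m)"

lemma gram_weight_shift:
  "gram_weight y (Suc r) (Suc t) = - of_nat (Suc t) * gram_weight (y - 1) r t"
proof -
  have "(\<Prod>m\<in>{Suc t..<Suc r}. y - of_nat m) = (\<Prod>m\<in>{t..<r}. (y - 1) - of_nat m)"
    unfolding prod.shift_bounds_Suc_ivl by (simp add: algebra_simps)
  then show ?thesis
    by (simp add: gram_weight_def algebra_simps)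
qed

lemma gram_weight_lower:
  assumes "t \<le> r"
  shows "gram_weight y (Suc r) t = (y - of_nat t) * ((-1) ^ t * of_nat (fact t)) *
    (\<Prod>m\<in>{t..<r}. (y - 1) - of_nat m)"
proof -
  have "(\<Prod>m\<in>{t..<Suc r}. y - of_nat m) = (y - of_nat t) * (\<Prod>m\<in>{Suc t..<Suc r}. y - of_nat m)"
    using assms by (intro prod.atLeast_Suc_lessThan) simp
  also have "(\<Prod>m\<in>{Suc t..<Suc r}. y - of_nat m) = (\<Prod>m\<in>{t..<r}. (y - 1) - of_nat m)"
    unfolding prod.shift_bounds_Suc_ivl by (simp add: algebra_simps)
  finally have split: "(\<Prod>m\<in>{t..<Suc r}. y - of_nat m) =
      (y - of_nat t) * (\<Prod>m\<in>{t..<r}. (y - 1) - of_nat m)" .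
  show ?thesis
    unfolding gram_weight_def split by (simp only: mult_ac)
qed

text \<open>Both terms are multiples of the weight for y - 1, with coefficients y - t and -(t + 1);
  in the difference t cancels. This makes the weights an eigenfamily of the recursion for
  \<open>johnson_eig\<close>.\<close>

lemma gram_weight_diff:
  assumes "t \<le> r"
  shows "gram_weight y (Suc r) t - gram_weight y (Suc r) (Suc t) = (y + 1) * gram_weight (y - 1) r t"
  unfolding gram_weight_lower[OF assms] gram_weight_shift
  by (simp add: gram_weight_def algebra_simps)

lemma gram_weight_Suc:
  assumes "t \<le> r"
  shows "gram_weight y (Suc r) t = (y - of_nat r) * gram_weight y r t"
proof -
  have "{t..<Suc r} = insert r {t..<r}"
    using assms by auto
  then show ?thesis
    unfolding gram_weight_def by (simp only: prod.insert finite_atLeastLessThan) simp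
qed

text \<open>The binomial r - l over u kills all u > r - l, so w is read only at arguments u + j
  \<le> r. That is the range in which \<open>gram_weight_diff\<close> holds.\<close>

lemma johnson_eig_cong:
  assumes "l \<le> s" "l \<le> r" "\<And>t. t \<le> r \<Longrightarrow> w t = w' t"
  shows "johnson_eig l s r w = johnson_eig l s r w'"
  unfolding johnson_eig_closed[OF assms(1,2)]
proof (intro sum.cong refl)
  fix u assume "u \<in> {..s - l}"
  show "of_nat (((s - l) choose u) * ((r - l) choose u)) *
       (\<Sum>j\<le>l. (-1) ^ j * of_nat (l choose j) * w (u + j)) =
    of_nat (((s - l) choose u) * ((r - l) choose u)) *
       (\<Sum>j\<le>l. (-1) ^ j * of_nat (l choose j) * w' (u + j))"
  proof (cases "u \<le> r - l")
    case True
    then have "w (u + j) = w' (u + j)" if "j \<le> l" for j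
      using assms that by (intro assms(3)) linarith
    then show ?thesis by simp
  qed (simp add: binomial_eq_0)
qed

lemma johnson_eig_scale:
  "l \<le> s \<Longrightarrow> l \<le> r \<Longrightarrow> johnson_eig l s r (\<lambda>t. c * w t) = c * johnson_eig l s r w"
  by (simp add: johnson_eig_closed sum_distrib_left mult_ac)

text \<open>A Vandermonde-type identity. Pascal's rule in s leaves the sum for s plus a remainder
  that is -r times the sum for r - 1 and y - 1, so the induction must leave r and y free.\<close>

lemma johnson_eig_gram_weight_0:
  "(\<Sum>u\<le>s. of_nat ((s choose u) * (r choose u)) * gram_weight y r u) =
    (\<Prod>j<r. y - of_nat s - of_nat j)"
proof (induction s arbitrary: r y)
  case 0
  then show ?case by (simp add: gram_weight_def lessThan_atLeast0)
next
  case (Suc s)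
  let ?f = "\<lambda>s u. of_nat ((s choose u) * (r choose u)) * gram_weight y r u"
  have "(\<Sum>u\<le>Suc s. ?f (Suc s) u) = (?f s 0 + (\<Sum>u\<le>s. ?f s (Suc u))) +
      (\<Sum>u\<le>s. of_nat ((s choose u) * (r choose Suc u)) * gram_weight y r (Suc u))"
    by (simp only: sum.atMost_Suc_shift) (simp add: algebra_simps sum.distrib)
  also have "?f s 0 + (\<Sum>u\<le>s. ?f s (Suc u)) = (\<Sum>u\<le>s. ?f s u)"
    using sum.atMost_Suc_shift[of "?f s" s] by (simp add: binomial_eq_0)
  also have "\<dots> = (\<Prod>j<r. y - of_nat s - of_nat j)"
    by (rule Suc.IH)
  finally have split: "(\<Sum>u\<le>Suc s. ?f (Suc s) u) = (\<Prod>j<r. y - of_nat s - of_nat j) +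
      (\<Sum>u\<le>s. of_nat ((s choose u) * (r choose Suc u)) * gram_weight y r (Suc u))" .
  show ?case
  proof (cases r)
    case 0
    then show ?thesis unfolding split by simp
  next
    case (Suc r')
    \<comment> \<open>The factor u + 1 from the factorial is absorbed by the binomial: (u + 1) C(r,
      u + 1) = r C(r - 1, u).\<close>
    have "of_nat ((s choose u) * (r choose Suc u)) * gram_weight y r (Suc u) =
        - of_nat r * (of_nat ((s choose u) * (r' choose u)) * gram_weight (y - 1) r' u)" for u
    proof -
      have "of_nat (Suc u) * of_nat (r choose Suc u) = (of_nat r * of_nat (r' choose u) :: 'a)"
        unfolding Suc by (simp only: of_nat_mult[symmetric] Suc_times_binomial)
      moreover have "of_nat ((s choose u) * (r choose Suc u)) * gram_weight y r (Suc u) =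
          - of_nat (s choose u) * (of_nat (Suc u) * of_nat (r choose Suc u)) * gram_weight (y - 1) r' u"
        unfolding Suc gram_weight_shift by (simp add: mult_ac del: of_nat_Suc binomial_Suc_Suc)
      ultimately show ?thesis
        by (simp add: mult_ac)
    qed
    then have rest: "(\<Sum>u\<le>s. of_nat ((s choose u) * (r choose Suc u)) * gram_weight y r (Suc u)) =
        - of_nat r * (\<Prod>j<r'. y - 1 - of_nat s - of_nat j)"
      by (simp only: sum_distrib_left[symmetric] Suc.IH)
    have first: "(\<Prod>j<r. y - of_nat s - of_nat j) =
        (y - of_nat s) * (\<Prod>j<r'. y - 1 - of_nat s - of_nat j)"
      unfolding Suc prod.lessThan_Suc_shift by (simp add: algebra_simps)
    \<comment> \<open>All three expressions share the product of r' factors; what remains is (y - s)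
      - r, the last factor of the claim.\<close>
    have goal: "(\<Prod>j<r. y - of_nat (Suc s) - of_nat j) =
        (\<Prod>j<r'. y - 1 - of_nat s - of_nat j) * (y - of_nat s - of_nat r)"
      unfolding Suc by (simp add: algebra_simps)
    show ?thesis
      unfolding split rest first goal by (simp add: algebra_simps)
  qed
qed

text \<open>Each step of the recursion contributes y + 1 and lowers y, s and r together. The first
  product thus runs through y + 1, y, y - 1, ..., whereas y - s is invariant and the second product
  only loses factors at its end.\<close>

lemma johnson_eig_gram_weight:
  assumes "l \<le> s" "l \<le> r"
  shows "johnson_eig l s r (gram_weight y r) =
    (\<Prod>i<l. y + 1 - of_nat i) * (\<Prod>j<r - l. y - of_nat s - of_nat j)"
  using assms
proof (induction l arbitrary: s r y)
  case 0
  then show ?case by (simp add: johnson_eig_gram_weight_0 del: of_nat_mult)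
next
  case (Suc l)
  then obtain s' r' where sr: "s = Suc s'" "r = Suc r'" "l \<le> s'" "l \<le> r'"
    by (metis Suc_le_D Suc_le_mono)
  have "johnson_eig (Suc l) s r (gram_weight y r) =
      johnson_eig l s' r' (\<lambda>t. (y + 1) * gram_weight (y - 1) r' t)"
    unfolding sr johnson_eig.simps diff_Suc_1
    using sr by (intro johnson_eig_cong gram_weight_diff) auto
  also have "\<dots> = (y + 1) * ((\<Prod>i<l. y - 1 + 1 - of_nat i) *
      (\<Prod>j<r' - l. y - 1 - of_nat s' - of_nat j))"
    using sr by (simp add: johnson_eig_scale Suc.IH)
  also have "\<dots> = (\<Prod>i<Suc l. y + 1 - of_nat i) * (\<Prod>j<r - Suc l. y - of_nat s - of_nat j)"
    unfolding prod.lessThan_Suc_shift sr by (simp add: algebra_simps)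
  finally show ?case .
qed

lemma gram_X_eq_gram_weight:
  assumes "t \<le> min s r"
  shows "gram_X s r (min s r - t) = gram_weight (X_var - of_nat s) r t"
  using assms by (simp add: gram_X_def gram_weight_def Let_def algebra_simps)

text \<open>The substitution t = u + j matches the two double sums; the rest of the proof controls
  the summation ranges.\<close>

lemma gram_eig_eq_johnson_eig:
  assumes l: "l \<le> min s r"
  shows "gram_eig s r l = johnson_eig l s r (gram_weight (X_var - of_nat s) r)"
proof -
  define m where "m = min s r - l"
  define w where "w = gram_weight (X_var - of_nat s) r"
  let ?b = "\<lambda>j t. binom (s - l) (int t - int j) * binom (r - l) (int t - int j)"
  let ?c = "\<lambda>u. ((s - l) choose u) * ((r - l) choose u)"
  have "(\<Sum>t = 0..min s r. of_int (?b j t) * w t) = (\<Sum>u\<le>s - l. of_nat (?c u) * w (u + j))"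
    if j: "j \<le> l" for j
  proof -
    \<comment> \<open>For t < j the lower entry is negative, and for t > m + j it exceeds s - l or r
      - l; in both cases \<open>binom\<close> gives 0.\<close>
    have "(\<Sum>t = 0..min s r. of_int (?b j t) * w t) = (\<Sum>t = j..m + j. of_int (?b j t) * w t)"
      using l j by (intro sum.mono_neutral_right) (auto simp: binom_def m_def min_def)
    also have "\<dots> = (\<Sum>u = 0..m. of_int (?b j (u + j)) * w (u + j))"
      using sum.shift_bounds_cl_nat_ivl[of "\<lambda>t. of_int (?b j t) * w t" 0 j m] by simp
    also have "\<dots> = (\<Sum>u = 0..m. of_nat (?c u) * w (u + j))"
      by (intro sum.cong) (auto simp: binom_def)
    also have "\<dots> = (\<Sum>u\<le>s - l. of_nat (?c u) * w (u + j))"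
      using l by (intro sum.mono_neutral_left) (auto simp: m_def min_def split: if_splits)
    finally show ?thesis .
  qed
  note inner = this
  have "gram_eig s r l = (\<Sum>t = 0..min s r. \<Sum>j\<le>l.
      (-1) ^ j * of_nat (l choose j) * (of_int (?b j t) * w t))"
    unfolding gram_eig_def
  proof (intro sum.cong refl)
    fix t assume "t \<in> {0..min s r}"
    then have "gram_X s r (min s r - t) = w t"
      by (simp only: gram_X_eq_gram_weight w_def atLeastAtMost_iff)
    then show "of_int (\<Sum>j = 0..l. (-1) ^ j * binom l (int j) * binom (s - l) (int t - int j)
          * binom (r - l) (int t - int j)) * gram_X s r (min s r - t) =
        (\<Sum>j\<le>l. (-1) ^ j * of_nat (l choose j) * (of_int (?b j t) * w t))"
      by (simp add: atMost_atLeast0 sum_distrib_right binom_def[of l] mult.assoc)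
  qed
  also have "\<dots> = (\<Sum>j\<le>l. (-1) ^ j * of_nat (l choose j) *
      (\<Sum>t = 0..min s r. of_int (?b j t) * w t))"
    by (subst sum.swap) (simp add: sum_distrib_left)
  also have "\<dots> = (\<Sum>j\<le>l. (-1) ^ j * of_nat (l choose j) * (\<Sum>u\<le>s - l. of_nat (?c u) * w (u + j)))"
    using inner by (intro sum.cong) auto
  also have "\<dots> = (\<Sum>u\<le>s - l. of_nat (?c u) * (\<Sum>j\<le>l. (-1) ^ j * of_nat (l choose j) * w (u + j)))"
    unfolding sum_distrib_left by (subst sum.swap) (simp add: mult_ac)
  also have "\<dots> = johnson_eig l s r w"
    using l by (simp add: johnson_eig_closed)
  finally show ?thesis
    by (simp add: w_def)
qed

theorem gram_eig_factorization:
  assumes "l \<le> min s r"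
  shows "gram_eig s r l = (\<Prod>i<l. X_var - of_int (int s - 1 + int i)) *
    (\<Prod>j<r - l. X_var - of_int (int (2 * s + j)))"
proof -
  have "gram_eig s r l = (\<Prod>i<l. X_var - of_nat s + 1 - of_nat i) *
    (\<Prod>j<r - l. X_var - of_nat s - of_nat s - of_nat j)"
    using assms unfolding gram_eig_eq_johnson_eig[OF assms] by (intro johnson_eig_gram_weight) auto
  also have "(\<Prod>i<l. X_var - of_nat s + 1 - of_nat i) =
      (\<Prod>i<l. X_var - of_int (int s - 1 + int i))"
    by (intro prod.cong) (auto simp: algebra_simps)
  also have "(\<Prod>j<r - l. X_var - of_nat s - of_nat s - of_nat j) =
      (\<Prod>j<r - l. X_var - of_int (int (2 * s + j)))"
    by (intro prod.cong) (auto simp: algebra_simps)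
  finally show ?thesis .
qed

section \<open>The Johnson scheme operator\<close>

definition subsets_of_card :: "'a set \<Rightarrow> nat \<Rightarrow> 'a set set" where
  "subsets_of_card \<Omega> s = {M. M \<subseteq> \<Omega> \<and> card M = s}"

lemma finite_subsets_of_card [simp]: "finite \<Omega> \<Longrightarrow> finite (subsets_of_card \<Omega> s)"
  unfolding subsets_of_card_def by simp

lemma subsets_of_cardD:
  assumes "M \<in> subsets_of_card \<Omega> s" "finite \<Omega>"
  shows "M \<subseteq> \<Omega>" "card M = s" "finite M"
  using assms finite_subset by (auto simp: subsets_of_card_def)

text \<open>A c-subset meeting P in v points is a v-subset of P together with a (c - v)-subset of Q.
  This serves both the row sums (P = M) and the count of the sets above L (P = M - L).\<close>

lemma sum_subsets_of_card_inter:
  fixes g :: "nat \<Rightarrow> 'b::comm_semiring_1"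
  assumes "finite P" "finite Q" "P \<inter> Q = {}"
  shows "(\<Sum>S\<in>subsets_of_card (P \<union> Q) c. g (card (S \<inter> P))) =
    (\<Sum>v\<le>c. of_nat ((card P choose v) * (card Q choose (c - v))) * g v)"
proof -
  have bound: "card (S \<inter> P) \<le> c" if "S \<in> subsets_of_card (P \<union> Q) c" for S
    using subsets_of_cardD[OF that] assms card_mono[of S "S \<inter> P"] by auto
  have fibre: "card {S \<in> subsets_of_card (P \<union> Q) c. card (S \<inter> P) = v} =
      (card P choose v) * (card Q choose (c - v))" if "v \<le> c" for v
  proof -
    have split: "card S = card (S \<inter> P) + card (S \<inter> Q)" if "S \<subseteq> P \<union> Q" for S
    proof -
      have "S = (S \<inter> P) \<union> (S \<inter> Q)" "finite (S \<inter> P)" "finite (S \<inter> Q)" "(S \<inter> P) \<inter> (S \<inter> Q) = {}"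
        using that assms by auto
      then show ?thesis
        by (metis card_Un_disjoint)
    qed
    have "bij_betw (\<lambda>(U, V). U \<union> V) (subsets_of_card P v \<times> subsets_of_card Q (c - v))
        {S \<in> subsets_of_card (P \<union> Q) c. card (S \<inter> P) = v}"
    proof (rule bij_betw_byWitness[where f' = "\<lambda>S. (S \<inter> P, S \<inter> Q)"])
      show "\<forall>a\<in>subsets_of_card P v \<times> subsets_of_card Q (c - v).
          (\<lambda>S. (S \<inter> P, S \<inter> Q)) ((\<lambda>(U, V). U \<union> V) a) = a"
        using assms by (auto simp: subsets_of_card_def)
      show "\<forall>S\<in>{S \<in> subsets_of_card (P \<union> Q) c. card (S \<inter> P) = v}.
          (\<lambda>(U, V). U \<union> V) (S \<inter> P, S \<inter> Q) = S"
        by (auto simp: subsets_of_card_def)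
      show "(\<lambda>(U, V). U \<union> V) ` (subsets_of_card P v \<times> subsets_of_card Q (c - v))
          \<subseteq> {S \<in> subsets_of_card (P \<union> Q) c. card (S \<inter> P) = v}"
      proof clarify
        fix U V assume UV: "U \<in> subsets_of_card P v" "V \<in> subsets_of_card Q (c - v)"
        then have "(U \<union> V) \<inter> P = U" "(U \<union> V) \<inter> Q = V" "U \<union> V \<subseteq> P \<union> Q"
          using assms by (auto simp: subsets_of_card_def)
        then show "U \<union> V \<in> subsets_of_card (P \<union> Q) c \<and> card ((U \<union> V) \<inter> P) = v"
          using split[of "U \<union> V"] UV \<open>v \<le> c\<close> by (simp add: subsets_of_card_def)
      qed
      show "(\<lambda>S. (S \<inter> P, S \<inter> Q)) ` {S \<in> subsets_of_card (P \<union> Q) c. card (S \<inter> P) = v}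
          \<subseteq> subsets_of_card P v \<times> subsets_of_card Q (c - v)"
        using split by (fastforce simp: subsets_of_card_def)
    qed
    from bij_betw_same_card[OF this] show ?thesis
      using assms by (simp add: card_cartesian_product subsets_of_card_def n_subsets)
  qed
  have "(\<Sum>S\<in>subsets_of_card (P \<union> Q) c. g (card (S \<inter> P))) =
      (\<Sum>v\<le>c. \<Sum>S\<in>{S \<in> subsets_of_card (P \<union> Q) c. card (S \<inter> P) = v}. g (card (S \<inter> P)))"
    using assms bound by (intro sum.group[symmetric]) auto
  also have "\<dots> = (\<Sum>v\<le>c. of_nat ((card P choose v) * (card Q choose (c - v))) * g v)"
    by (intro sum.cong refl) (simp add: fibre[symmetric])
  finally show ?thesis .
qed

lemma sum_Pow_card:
  fixes g :: "nat \<Rightarrow> 'b::comm_semiring_1"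
  assumes "finite A"
  shows "(\<Sum>I\<in>Pow A. g (card I)) = (\<Sum>j\<le>card A. of_nat (card A choose j) * g j)"
proof -
  have "(\<Sum>I\<in>Pow A. g (card I)) = (\<Sum>j\<le>card A. \<Sum>I\<in>{I \<in> Pow A. card I = j}. g (card I))"
    using assms by (intro sum.group[symmetric]) (auto intro: card_mono)
  also have "\<dots> = (\<Sum>j\<le>card A. of_nat (card A choose j) * g j)"
    using assms by (intro sum.cong refl) (simp add: n_subsets)
  finally show ?thesis .
qed

text \<open>The action of an arbitrary element of the Bose-Mesner algebra of the Johnson scheme, w t
  being the coefficient of the relation "at distance t".\<close>

definition johnson_op :: "(nat \<Rightarrow> 'b::comm_ring_1) \<Rightarrow> 'a set \<Rightarrow> nat \<Rightarrow> ('a set \<Rightarrow> 'b) \<Rightarrow> 'a set \<Rightarrow> 'b" where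
  "johnson_op w \<Omega> s v M = (\<Sum>M'\<in>subsets_of_card \<Omega> s. w (card (M - M')) * v M')"

fun johnson_vec :: "('a \<times> 'a) list \<Rightarrow> 'a set \<Rightarrow> 'b::comm_ring_1" where
  "johnson_vec [] M = 1"
| "johnson_vec ((a, b) # ps) M = (of_bool (a \<in> M) - of_bool (b \<in> M)) * johnson_vec ps M"

lemma johnson_vec_cong:
  "M \<inter> (fst ` set ps \<union> snd ` set ps) = M' \<inter> (fst ` set ps \<union> snd ` set ps) \<Longrightarrow>
    johnson_vec ps M = johnson_vec ps M'"
proof (induction ps)
  case (Cons p ps)
  obtain a b where p: "p = (a, b)" by fastforce
  have "johnson_vec ps M = (johnson_vec ps M' :: 'b)"
    using Cons.prems by (intro Cons.IH) auto
  moreover have "a \<in> M \<longleftrightarrow> a \<in> M'" "b \<in> M \<longleftrightarrow> b \<in> M'"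
    using Cons.prems p by auto
  ultimately show ?case by (simp add: p)
qed simp

text \<open>Deleting a is a bijection onto the s-subsets of a ground set with two points fewer. This
  is why s and r drop by one together.\<close>

lemma sum_subsets_of_card_insert:
  assumes "finite \<Omega>" "a \<in> \<Omega>" "b \<in> \<Omega>" "a \<noteq> b"
  shows "(\<Sum>M\<in>subsets_of_card \<Omega> (Suc s). of_bool (a \<in> M \<and> b \<notin> M) * (f M :: 'b::comm_ring_1)) =
    (\<Sum>N\<in>subsets_of_card (\<Omega> - {a, b}) s. f (insert a N))"
proof -
  have "(\<Sum>M\<in>subsets_of_card \<Omega> (Suc s). of_bool (a \<in> M \<and> b \<notin> M) * f M) =
      (\<Sum>M\<in>{M \<in> subsets_of_card \<Omega> (Suc s). a \<in> M \<and> b \<notin> M}. f M)"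
    using assms by (intro sum.mono_neutral_cong_right) auto
  also have "\<dots> = (\<Sum>N\<in>subsets_of_card (\<Omega> - {a, b}) s. f (insert a N))"
  proof (rule sum.reindex_bij_witness[where i = "insert a" and j = "\<lambda>M. M - {a}"])
    fix N assume N: "N \<in> subsets_of_card (\<Omega> - {a, b}) s"
    with assms have "finite N" "a \<notin> N"
      using finite_subset by (fastforce simp: subsets_of_card_def)+
    with N assms show "insert a N \<in> {M \<in> subsets_of_card \<Omega> (Suc s). a \<in> M \<and> b \<notin> M}"
      by (auto simp: subsets_of_card_def)
    from \<open>a \<notin> N\<close> show "insert a N - {a} = N" by simp
  next
    fix M assume M: "M \<in> {M \<in> subsets_of_card \<Omega> (Suc s). a \<in> M \<and> b \<notin> M}"
    with assms have "finite M"
      using finite_subset by (fastforce simp: subsets_of_card_def)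
    with M show "M - {a} \<in> subsets_of_card (\<Omega> - {a, b}) s"
      by (auto simp: subsets_of_card_def)
    from M show "insert a (M - {a}) = M" "f (insert a (M - {a})) = f M"
      by (auto simp: insert_absorb)
  qed
  finally show ?thesis .
qed

text \<open>The factor for (a, b) vanishes on sets containing both points or neither. The remaining
  sets pair up as \<open>insert a N\<close> and \<open>insert b N\<close>, whose distances to M
  differ by at most one, so the pair leaves a difference of consecutive weights.\<close>

lemma johnson_op_vec:
  assumes "finite \<Omega>" "card \<Omega> = s + r" "length ps \<le> s" "length ps \<le> r"
    and "distinct (map fst ps @ map snd ps)" "fst ` set ps \<union> snd ` set ps \<subseteq> \<Omega>"
    and "M \<in> subsets_of_card \<Omega> s"
  shows "johnson_op w \<Omega> s (johnson_vec ps) M = johnson_eig (length ps) s r w * johnson_vec ps M"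
  using assms
proof (induction ps arbitrary: \<Omega> s r w M)
  case Nil
  note M = subsets_of_cardD[OF Nil(7,1)]
  have \<Omega>: "M \<union> (\<Omega> - M) = \<Omega>" and cards: "card (\<Omega> - M) = r"
    using M Nil by (auto simp: card_Diff_subset)
  have "johnson_op w \<Omega> s (johnson_vec []) M = (\<Sum>S\<in>subsets_of_card (M \<union> (\<Omega> - M)) s. w (s - card (S \<inter> M)))"
    unfolding johnson_op_def \<Omega> using M
    by (intro sum.cong refl) (simp add: card_Diff_subset_Int Int_commute)
  also have "\<dots> = (\<Sum>v\<le>s. of_nat ((s choose v) * (r choose (s - v))) * w (s - v))"
    using M Nil(1) cards by (subst sum_subsets_of_card_inter[where g = "\<lambda>i. w (s - i)"]) auto
  also have "\<dots> = (\<Sum>u\<le>s. of_nat ((s choose u) * (r choose u)) * w u)"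
    by (rule sum.reindex_bij_witness[where i = "\<lambda>u. s - u" and j = "\<lambda>u. s - u"])
      (auto simp: binomial_symmetric[symmetric])
  finally show ?case by (simp add: johnson_op_def)
next
  case (Cons p ps)
  obtain a b where p: "p = (a, b)" by fastforce
  from Cons.prems obtain s' r' where sr: "s = Suc s'" "r = Suc r'"
    by (metis Suc_le_D length_Cons)
  define \<Omega>' where "\<Omega>' = \<Omega> - {a, b}"
  \<comment> \<open>The part of M visible in the smaller ground set; the induction hypothesis is
    applied to K in place of M.\<close>
  define K where "K = M - {a, b}"
  have ab: "a \<in> \<Omega>" "b \<in> \<Omega>" "a \<noteq> b" and out: "a \<notin> fst ` set ps \<union> snd ` set ps" "b \<notin> fst ` set ps \<union> snd ` set ps"
    using Cons.prems(5,6) by (auto simp: p)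
  note M = subsets_of_cardD[OF Cons.prems(7,1)]
  have card': "card \<Omega>' = s' + r'"
    using Cons.prems(1,2) ab by (simp add: \<Omega>'_def sr card_Diff_subset)
  define f where "f = (\<lambda>M'. w (card (M - M')) * johnson_vec ps M')"
  define c where "c = (\<lambda>N. card (K - N))"
  have vec: "johnson_vec ps (insert x N) = (johnson_vec ps N :: 'b)" if "x \<in> {a, b}" for x N
    using out that by (intro johnson_vec_cong) auto
  \<comment> \<open>\<open>insert a N\<close> contains a but not b, so a point b of M adds one to
    the distance; likewise with a and b exchanged.\<close>
  have fa: "f (insert a N) = w (c N + of_bool (b \<in> M)) * johnson_vec ps N"
    and fb: "f (insert b N) = w (c N + of_bool (a \<in> M)) * johnson_vec ps N"
    if "N \<in> subsets_of_card \<Omega>' s'" for N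
  proof -
    have N: "a \<notin> N" "b \<notin> N" using that by (auto simp: subsets_of_card_def \<Omega>'_def)
    then have "M - insert a N = (if b \<in> M then insert b (K - N) else K - N)"
      "M - insert b N = (if a \<in> M then insert a (K - N) else K - N)"
      using ab by (auto simp: K_def)
    then have "card (M - insert a N) = c N + of_bool (b \<in> M)"
      "card (M - insert b N) = c N + of_bool (a \<in> M)"
      using M(3) by (auto simp: c_def K_def)
    then show "f (insert a N) = w (c N + of_bool (b \<in> M)) * johnson_vec ps N"
      "f (insert b N) = w (c N + of_bool (a \<in> M)) * johnson_vec ps N"
      by (simp_all add: f_def vec)
  qed
  have "johnson_op w \<Omega> s (johnson_vec (p # ps)) M =
      (\<Sum>M'\<in>subsets_of_card \<Omega> (Suc s'). of_bool (a \<in> M' \<and> b \<notin> M') * f M' - of_bool (b \<in> M' \<and> a \<notin> M') * f M')"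
    unfolding johnson_op_def sr by (intro sum.cong) (auto simp: p f_def algebra_simps)
  also have "\<dots> = (\<Sum>N\<in>subsets_of_card \<Omega>' s'. f (insert a N)) - (\<Sum>N\<in>subsets_of_card \<Omega>' s'. f (insert b N))"
    unfolding sum_subtractf \<Omega>'_def sum_subsets_of_card_insert[OF Cons.prems(1) ab]
      sum_subsets_of_card_insert[OF Cons.prems(1) ab(2,1) ab(3)[symmetric]] insert_commute[of b a]
    ..
  also have "\<dots> = (\<Sum>N\<in>subsets_of_card \<Omega>' s'.
      (w (c N + of_bool (b \<in> M)) - w (c N + of_bool (a \<in> M))) * johnson_vec ps N)"
    by (simp add: fa fb sum_subtractf left_diff_distrib)
  also have "\<dots> = (of_bool (a \<in> M) - of_bool (b \<in> M)) *
      (\<Sum>N\<in>subsets_of_card \<Omega>' s'. (w (c N) - w (Suc (c N))) * johnson_vec ps N)"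
    unfolding sum_distrib_left by (intro sum.cong refl) (auto simp: algebra_simps)
  also have "\<dots> = (of_bool (a \<in> M) - of_bool (b \<in> M)) *
      (johnson_eig (length ps) s' r' (\<lambda>t. w t - w (Suc t)) * johnson_vec ps M)"
  proof (cases "(a \<in> M) = (b \<in> M)")
    \<comment> \<open>Otherwise the factor for (a, b) is 0 on both sides. Here M contains exactly
      one of the two points, so K has the s' elements that the induction hypothesis demands.\<close>
    case False
    then have "card K = s'" 
      using M sr ab by (cases "a \<in> M") (auto simp: K_def Diff_insert0 card_Diff_subset)
    then have K: "K \<in> subsets_of_card \<Omega>' s'"
      using M by (auto simp: subsets_of_card_def K_def \<Omega>'_def)
    have "(\<Sum>N\<in>subsets_of_card \<Omega>' s'. (w (c N) - w (Suc (c N))) * johnson_vec ps N) =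
        johnson_op (\<lambda>t. w t - w (Suc t)) \<Omega>' s' (johnson_vec ps) K"
      by (simp add: johnson_op_def c_def)
    also have "\<dots> = johnson_eig (length ps) s' r' (\<lambda>t. w t - w (Suc t)) * johnson_vec ps K"
      using Cons.prems out K card' by (intro Cons.IH) (auto simp: sr p \<Omega>'_def)
    also have "johnson_vec ps K = (johnson_vec ps M :: 'b)"
      using out by (intro johnson_vec_cong) (auto simp: K_def)
    finally show ?thesis by simp
  qed simp
  also have "\<dots> = johnson_eig (length (p # ps)) s r w * johnson_vec (p # ps) M"
    by (simp add: p sr mult_ac)
  finally show ?case .
qed

section \<open>Finite differences and the completeness of the list of Johnson eigenvalues\<close>

definition fwd_diff :: "(nat \<Rightarrow> 'a::comm_ring_1) \<Rightarrow> nat \<Rightarrow> 'a" where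
  "fwd_diff f i = f (Suc i) - f i"

text \<open>Newton's expansion rewrites a function of \<open>card (L \<inter> M)\<close> as a sum
  over the subsets of \<open>L \<inter> M\<close>; in that shape the minimality of L can be
  used.\<close>

lemma newton_forward:
  "f n = (\<Sum>j\<le>n. of_nat (n choose j) * (fwd_diff ^^ j) f 0)"
proof (induction n arbitrary: f)
  case 0
  then show ?case by simp
next
  case (Suc n)
  let ?d = "\<lambda>j. (fwd_diff ^^ j) f 0"
  have "f (Suc n) = f n + fwd_diff f n"
    by (simp add: fwd_diff_def)
  also have "\<dots> = (\<Sum>j\<le>n. of_nat (n choose j) * ?d j) + (\<Sum>j\<le>n. of_nat (n choose j) * ?d (Suc j))"
    using Suc.IH[of f] Suc.IH[of "fwd_diff f"] by (simp only: funpow_Suc_right o_apply)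
  also have "(\<Sum>j\<le>n. of_nat (n choose j) * ?d j) = (\<Sum>j\<le>Suc n. of_nat (n choose j) * ?d j)"
    by (simp add: binomial_eq_0)
  also have "\<dots> = ?d 0 + (\<Sum>j\<le>n. of_nat (n choose Suc j) * ?d (Suc j))"
    by (simp only: sum.atMost_Suc_shift) simp
  also have "\<dots> + (\<Sum>j\<le>n. of_nat (n choose j) * ?d (Suc j)) =
      ?d 0 + (\<Sum>j\<le>n. of_nat (Suc n choose Suc j) * ?d (Suc j))"
    by (simp add: algebra_simps sum.distrib del: funpow.simps)
  also have "\<dots> = (\<Sum>j\<le>Suc n. of_nat (Suc n choose j) * ?d j)"
    by (simp only: sum.atMost_Suc_shift) simp
  finally show ?case .
qed

lemma fwd_diff_funpow_cong:
  "(\<And>i. i \<le> l \<Longrightarrow> f i = g i) \<Longrightarrow> (fwd_diff ^^ l) f 0 = (fwd_diff ^^ l) g 0"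
proof (induction l arbitrary: f g)
  case (Suc l)
  have "fwd_diff f i = fwd_diff g i" if "i \<le> l" for i
    using Suc.prems that by (simp add: fwd_diff_def)
  then show ?case
    unfolding funpow_Suc_right o_apply by (rule Suc.IH)
qed simp

text \<open>The total weight of the s-sets M' above an l-set L, as seen from an s-set M with i =
  \<open>card (L \<inter> M)\<close>. Here v counts the points that M' takes from M - L, a set of s
  - i points; the other s - l - v points come from the r - l + i points outside L and M.\<close>

definition johnson_count :: "nat \<Rightarrow> nat \<Rightarrow> nat \<Rightarrow> (nat \<Rightarrow> 'a::comm_ring_1) \<Rightarrow> nat \<Rightarrow> 'a" where
  "johnson_count l s r w i = (\<Sum>v\<le>s - l. of_nat (((s - i) choose v) * ((r - l + i) choose (s - l - v))) * w (s - i - v))"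

text \<open>Pascal's rule splits the second binomial at i + 1 and the first one at i. Both
  expansions contain the same mixed sum \<open>c\<close>, which cancels; what is left is the sum for
  the differenced weight. This is the recursion of \<open>johnson_eig\<close>.\<close>

lemma fwd_diff_johnson_count:
  assumes "i \<le> l" "l \<le> s" "l \<le> r"
  shows "fwd_diff (johnson_count (Suc l) (Suc s) (Suc r) w) i =
    johnson_count l s r (\<lambda>t. w t - w (Suc t)) i"
proof -
  define n where "n = s - l"
  define p where "p = s - i"
  define q where "q = r - l + i"
  define x :: "nat \<Rightarrow> 'a" where "x = (\<lambda>v. of_nat ((p choose v) * (q choose (n - v))) * w (p - v))"
  define x' :: "nat \<Rightarrow> 'a" where "x' = (\<lambda>v. of_nat ((p choose v) * (q choose (n - v))) * w (Suc (p - v)))"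
  define c :: 'a where "c = (\<Sum>v<n. of_nat ((p choose v) * (q choose (n - Suc v))) * w (p - v))"
  have np: "n \<le> p"
    using assms by (simp add: n_def p_def)
  have "johnson_count (Suc l) (Suc s) (Suc r) w (Suc i) =
      (\<Sum>v\<le>n. of_nat ((p choose v) * (Suc q choose (n - v))) * w (p - v))"
    using assms by (simp add: johnson_count_def n_def p_def q_def)
  \<comment> \<open>The term v = n is set apart because its second binomial has lower entry 0, where
    Pascal's rule does not apply.\<close>
  also have "\<dots> = (\<Sum>v<n. of_nat ((p choose v) * (Suc q choose Suc (n - Suc v))) * w (p - v)) +
      of_nat (p choose n) * w (p - n)"
    by (simp add: lessThan_Suc_atMost[symmetric] Suc_diff_Suc)
  also have "(\<Sum>v<n. of_nat ((p choose v) * (Suc q choose Suc (n - Suc v))) * w (p - v)) = (\<Sum>v<n. x v) + c"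
    unfolding c_def x_def sum.distrib[symmetric]
  proof (intro sum.cong refl)
    fix v assume "v \<in> {..<n}"
    then have "n - v = Suc (n - Suc v)" by auto
    then show "of_nat ((p choose v) * (Suc q choose Suc (n - Suc v))) * w (p - v) =
        of_nat ((p choose v) * (q choose (n - v))) * w (p - v) +
        of_nat ((p choose v) * (q choose (n - Suc v))) * w (p - v)"
      by (simp add: algebra_simps)
  qed
  also have "\<dots> + of_nat (p choose n) * w (p - n) = (\<Sum>v\<le>n. x v) + c"
    by (simp add: lessThan_Suc_atMost[symmetric] x_def)
  finally have 1: "johnson_count (Suc l) (Suc s) (Suc r) w (Suc i) = (\<Sum>v\<le>n. x v) + c" .
  have "johnson_count (Suc l) (Suc s) (Suc r) w i =
      (\<Sum>v\<le>n. of_nat ((Suc p choose v) * (q choose (n - v))) * w (Suc p - v))"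
    using assms by (simp add: johnson_count_def n_def p_def q_def Suc_diff_le)
  also have "\<dots> = of_nat (q choose n) * w (Suc p) +
      (\<Sum>v<n. of_nat ((Suc p choose Suc v) * (q choose (n - Suc v))) * w (p - v))"
    by (simp only: sum.atMost_shift) simp
  also have "(\<Sum>v<n. of_nat ((Suc p choose Suc v) * (q choose (n - Suc v))) * w (p - v)) =
      (\<Sum>v<n. x' (Suc v)) + c"
    unfolding c_def x'_def sum.distrib[symmetric] using np
    by (intro sum.cong) (auto simp: algebra_simps Suc_diff_Suc)
  also have "of_nat (q choose n) * w (Suc p) + \<dots> = (\<Sum>v\<le>n. x' v) + c"
    by (simp only: sum.atMost_shift) (simp add: x'_def)
  finally have 2: "johnson_count (Suc l) (Suc s) (Suc r) w i = (\<Sum>v\<le>n. x' v) + c" .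
  have "johnson_count l s r (\<lambda>t. w t - w (Suc t)) i = (\<Sum>v\<le>n. x v) - (\<Sum>v\<le>n. x' v)"
    unfolding johnson_count_def x_def x'_def sum_subtractf[symmetric]
    by (simp add: n_def p_def q_def algebra_simps)
  then show ?thesis
    unfolding fwd_diff_def 1 2 by simp
qed

text \<open>After l differences both sides have reached l = 0, where complementing the summation
  index identifies them.\<close>

lemma fwd_diff_funpow_johnson_count:
  assumes "l \<le> s" "l \<le> r"
  shows "(fwd_diff ^^ l) (johnson_count l s r w) 0 = johnson_eig l s r w"
  using assms
proof (induction l arbitrary: s r w)
  case 0
  have "(\<Sum>v\<le>s. of_nat ((s choose v) * (r choose (s - v))) * w (s - v)) =
      (\<Sum>u\<le>s. of_nat ((s choose u) * (r choose u)) * w u)"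
    by (rule sum.reindex_bij_witness[where i = "\<lambda>u. s - u" and j = "\<lambda>u. s - u"])
      (auto simp: binomial_symmetric[symmetric])
  then show ?case by (simp add: johnson_count_def)
next
  case (Suc l)
  then obtain s' r' where sr: "s = Suc s'" "r = Suc r'" "l \<le> s'" "l \<le> r'"
    by (metis Suc_le_D Suc_le_mono)
  have "(fwd_diff ^^ Suc l) (johnson_count (Suc l) s r w) 0 =
      (fwd_diff ^^ l) (fwd_diff (johnson_count (Suc l) s r w)) 0"
    by (simp only: funpow_Suc_right o_apply)
  also have "\<dots> = (fwd_diff ^^ l) (johnson_count l s' r' (\<lambda>t. w t - w (Suc t))) 0"
    unfolding sr(1,2) using sr by (intro fwd_diff_funpow_cong fwd_diff_johnson_count)
  finally show ?case
    using sr by (simp add: Suc.IH)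
qed

text \<open>The set Q of points outside L and M has s + r - (l + s - i) elements. The assumption l
  \<le> r makes this equal to r - l + i without truncation.\<close>

lemma sum_johnson_above:
  assumes "finite \<Omega>" "card \<Omega> = s + r" "M \<in> subsets_of_card \<Omega> s"
    and "L \<subseteq> \<Omega>" "card L = l" "l \<le> s" "l \<le> r"
  shows "(\<Sum>M'\<in>{M' \<in> subsets_of_card \<Omega> s. L \<subseteq> M'}. w (card (M' - M))) =
    johnson_count l s r w (card (L \<inter> M))"
proof -
  note M = subsets_of_cardD[OF assms(3,1)]
  have finL: "finite L"
    using assms finite_subset by blast
  define P where "P = M - L"
  define Q where "Q = \<Omega> - L - M"
  define i where "i = card (L \<inter> M)"
  have i: "i \<le> l" "i \<le> s"
    using card_mono[of L "L \<inter> M"] card_mono[of M "L \<inter> M"] finL M assms by (auto simp: i_def)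
  have cP: "card P = s - i"
    using M by (simp add: P_def i_def card_Diff_subset_Int Int_commute)
  have "card (L \<union> M) + i = l + s"
    using card_Un_Int[OF finL M(3)] assms M by (simp add: i_def)
  moreover have "card Q = s + r - card (L \<union> M)"
  proof -
    have "Q = \<Omega> - (L \<union> M)" "L \<union> M \<subseteq> \<Omega>" "finite (L \<union> M)"
      using M finL assms by (auto simp: Q_def)
    then show ?thesis
      using assms by (simp add: card_Diff_subset)
  qed
  ultimately have cQ: "card Q = r - l + i"
    using i assms by linarith
  have fin: "finite P" "finite Q" "P \<inter> Q = {}"
    using assms M by (auto simp: P_def Q_def)
  have PQ: "P \<union> Q = \<Omega> - L"
    using M assms by (auto simp: P_def Q_def)
  have "(\<Sum>M'\<in>{M' \<in> subsets_of_card \<Omega> s. L \<subseteq> M'}. w (card (M' - M))) =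
      (\<Sum>S\<in>subsets_of_card (P \<union> Q) (s - l). w (s - i - card (S \<inter> P)))"
  proof (rule sum.reindex_bij_witness[where i = "\<lambda>S. S \<union> L" and j = "\<lambda>M'. M' - L"])
    fix M' assume *: "M' \<in> {M' \<in> subsets_of_card \<Omega> s. L \<subseteq> M'}"
    then have M': "M' \<subseteq> \<Omega>" "card M' = s" "finite M'" "L \<subseteq> M'"
      using subsets_of_cardD[OF _ assms(1)] by auto
    then show "M' - L \<union> L = M'" by auto
    show "M' - L \<in> subsets_of_card (P \<union> Q) (s - l)"
      unfolding PQ using M' finL assms by (auto simp: subsets_of_card_def card_Diff_subset)
    \<comment> \<open>Sets of equal size are at symmetric distance, so the distance can be read off
      from what M' takes out of M.\<close>
    have "card (M' - M) = card (M - M')"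
      using M' M by (metis card_Diff_subset_Int finite_Int Int_commute)
    also have "M - M' = P - (M' - L) \<inter> P"
      using M' by (auto simp: P_def)
    also have "card \<dots> = s - i - card ((M' - L) \<inter> P)"
      using fin by (subst card_Diff_subset) (auto simp: cP)
    finally show "w (s - i - card ((M' - L) \<inter> P)) = w (card (M' - M))" by simp
  next
    fix S assume "S \<in> subsets_of_card (P \<union> Q) (s - l)"
    then have S: "S \<subseteq> \<Omega> - L" "card S = s - l" "finite S"
      using subsets_of_cardD[of S "\<Omega> - L" "s - l"] assms unfolding PQ by auto
    then show "S \<union> L - L = S" by auto
    have "card (S \<union> L) = s"
      using S finL assms by (subst card_Un_disjoint) auto
    then show "S \<union> L \<in> {M' \<in> subsets_of_card \<Omega> s. L \<subseteq> M'}"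
      using S assms by (auto simp: subsets_of_card_def)
  qed
  also have "\<dots> = johnson_count l s r w i"
    using fin by (subst sum_subsets_of_card_inter[where g = "\<lambda>v. w (s - i - v)"])
      (auto simp: johnson_count_def cP cQ)
  finally show ?thesis by (simp add: i_def)
qed

text \<open>\<open>W\<close> is the sum of v over the s-sets above L. Since \<open>W\<close> at the
  given set equals v there, a smallest L with nonzero \<open>W\<close> exists and has at most s
  points. In an integral domain the factor \<open>W L\<close> can be cancelled at the end.\<close>

lemma johnson_op_eigenvalue:
  fixes v :: "'a set \<Rightarrow> 'b::idom"
  assumes "finite \<Omega>" "card \<Omega> = s + r"
    and eig: "\<And>M. M \<in> subsets_of_card \<Omega> s \<Longrightarrow> johnson_op w \<Omega> s v M = c * v M"
    and nz: "M\<^sub>0 \<in> subsets_of_card \<Omega> s" "v M\<^sub>0 \<noteq> 0"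
  shows "\<exists>l\<le>min s r. c = johnson_eig l s r w"
proof -
  define W where "W = (\<lambda>L. \<Sum>M\<in>{M \<in> subsets_of_card \<Omega> s. L \<subseteq> M}. v M)"
  have W: "W L = (\<Sum>M\<in>subsets_of_card \<Omega> s. of_bool (L \<subseteq> M) * v M)" for L
    unfolding W_def using assms by (intro sum.mono_neutral_cong_left) auto
  have "{M \<in> subsets_of_card \<Omega> s. M\<^sub>0 \<subseteq> M} = {M\<^sub>0}"
    using nz assms(1) by (auto simp: subsets_of_card_def) (metis card_subset_eq finite_subset)+
  then have W0: "W M\<^sub>0 \<noteq> 0"
    using nz by (simp add: W_def)
  define l where "l = (LEAST n. \<exists>L\<subseteq>\<Omega>. card L = n \<and> W L \<noteq> 0)"
  have ex: "\<exists>L\<subseteq>\<Omega>. card L = s \<and> W L \<noteq> 0"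
    using W0 nz subsets_of_cardD[OF nz(1) assms(1)] by blast
  then have "\<exists>L\<subseteq>\<Omega>. card L = l \<and> W L \<noteq> 0"
    unfolding l_def by (rule LeastI)
  then obtain L where L: "L \<subseteq> \<Omega>" "card L = l" "W L \<noteq> 0" by blast
  have ls: "l \<le> s"
    unfolding l_def using ex by (rule Least_le)
  have finL: "finite L"
    using L(1) assms(1) by (rule finite_subset)
  have zero: "W I = 0" if "I \<subset> L" for I
  proof (rule ccontr)
    assume "W I \<noteq> 0"
    then have "l \<le> card I"
      unfolding l_def using that L by (intro Least_le) auto
    moreover have "card I < card L"
      using finL that by (rule psubset_card_mono)
    ultimately show False using L by simp
  qed
  \<comment> \<open>Exchanging the sums produces \<open>W I\<close> for every I \<subseteq> L; by
    minimality only I = L survives.\<close>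
  have collapse: "(\<Sum>M\<in>subsets_of_card \<Omega> s. (\<Sum>I\<in>Pow (L \<inter> M). g (card I)) * v M) = g l * W L" for g
  proof -
    have "(\<Sum>I\<in>Pow (L \<inter> M). g (card I)) = (\<Sum>I\<in>Pow L. of_bool (I \<subseteq> M) * g (card I))" for M
      using finL by (intro sum.mono_neutral_cong_left) auto
    then have "(\<Sum>M\<in>subsets_of_card \<Omega> s. (\<Sum>I\<in>Pow (L \<inter> M). g (card I)) * v M) =
        (\<Sum>M\<in>subsets_of_card \<Omega> s. (\<Sum>I\<in>Pow L. of_bool (I \<subseteq> M) * g (card I)) * v M)"
      by (simp only:)
    also have "\<dots> = (\<Sum>I\<in>Pow L. g (card I) * W I)"
      unfolding W sum_distrib_left sum_distrib_right by (subst sum.swap) (simp add: mult_ac)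
    also have "\<dots> = (\<Sum>I\<in>{L}. g (card I) * W I)"
      using finL zero by (intro sum.mono_neutral_right) auto
    finally show ?thesis by (simp add: L)
  qed
  \<comment> \<open>If l > r, every s-set meets L, as its complement has only r points. The
    alternating sum over the subsets of \<open>L \<inter> M\<close> is then 0 for each M, and
    \<open>collapse\<close> would give W L = 0.\<close>
  have lr: "l \<le> r"
  proof (rule ccontr)
    assume "\<not> l \<le> r"
    have "(\<Sum>I\<in>Pow (L \<inter> M). (-1) ^ card I) = (0 :: 'b)" if "M \<in> subsets_of_card \<Omega> s" for M
    proof -
      note M = subsets_of_cardD[OF that assms(1)]
      have "L \<inter> M \<noteq> {}"
      proof
        assume "L \<inter> M = {}"
        then have "l \<le> card (\<Omega> - M)"
          using L assms(1) unfolding L(2)[symmetric] by (intro card_mono) auto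
        then show False
          using M assms \<open>\<not> l \<le> r\<close> by (simp add: card_Diff_subset)
      qed
      then have "card (L \<inter> M) > 0"
        using finL by (simp add: card_gt_0_iff)
      then show ?thesis
        using finL choose_alternating_sum[of "card (L \<inter> M)", where 'a = 'b]
        by (subst sum_Pow_card[where g = "\<lambda>j. (-1) ^ j"]) (simp_all add: mult_ac)
    qed
    then have "(\<Sum>M\<in>subsets_of_card \<Omega> s. (\<Sum>I\<in>Pow (L \<inter> M). (-1) ^ card I) * v M) = 0"
      by simp
    then have "(-1) ^ l * W L = 0"
      using collapse[of "\<lambda>n. (-1) ^ n"] by simp
    with L show False by simp
  qed
  \<comment> \<open>Newton's expansion brings the weight above L into the form required by
    \<open>collapse\<close>, which then singles out the l-th difference, that is
    \<open>johnson_eig\<close>.\<close>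
  have above: "(\<Sum>M'\<in>{M' \<in> subsets_of_card \<Omega> s. L \<subseteq> M'}. w (card (M' - M))) =
      (\<Sum>I\<in>Pow (L \<inter> M). (fwd_diff ^^ card I) (johnson_count l s r w) 0)"
    if "M \<in> subsets_of_card \<Omega> s" for M
    unfolding sum_johnson_above[OF assms(1,2) that L(1,2) ls lr]
      newton_forward[of "johnson_count l s r w" "card (L \<inter> M)"]
    using finL by (subst sum_Pow_card[where g = "\<lambda>j. (fwd_diff ^^ j) (johnson_count l s r w) 0"]) simp_all
  have "c * W L = (\<Sum>M'\<in>{M' \<in> subsets_of_card \<Omega> s. L \<subseteq> M'}. johnson_op w \<Omega> s v M')"
    by (simp add: W_def sum_distrib_left eig)
  also have "\<dots> = (\<Sum>M\<in>subsets_of_card \<Omega> s.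
      (\<Sum>M'\<in>{M' \<in> subsets_of_card \<Omega> s. L \<subseteq> M'}. w (card (M' - M))) * v M)"
    unfolding johnson_op_def sum_distrib_right by (rule sum.swap)
  also have "\<dots> = (\<Sum>M\<in>subsets_of_card \<Omega> s.
      (\<Sum>I\<in>Pow (L \<inter> M). (fwd_diff ^^ card I) (johnson_count l s r w) 0) * v M)"
    using above by simp
  also have "\<dots> = johnson_eig l s r w * W L"
    using ls lr collapse[of "\<lambda>j. (fwd_diff ^^ j) (johnson_count l s r w) 0"]
    by (simp add: fwd_diff_funpow_johnson_count)
  finally show ?thesis
    using L ls lr by auto
qed

section \<open>Sums over coarsenings\<close>

lemma partition_on_disjointD:
  "partition_on Q R \<Longrightarrow> C \<in> R \<Longrightarrow> D \<in> R \<Longrightarrow> x \<in> C \<Longrightarrow> x \<in> D \<Longrightarrow> C = D"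
  by (auto simp: partition_on_def disjoint_def)

lemma partition_on_insert_element:
  assumes R: "partition_on Q R" and C: "C \<in> insert {} R" and b: "b \<notin> Q"
  shows "partition_on (insert b Q) (insert (insert b C) (R - {C}))"
proof (rule partition_onI)
  show "\<Union> (insert (insert b C) (R - {C})) = insert b Q"
    using R C by (auto simp: partition_on_def)
  show "{} \<notin> insert (insert b C) (R - {C})"
    using R by (auto simp: partition_on_def)
  fix p q assume "p \<in> insert (insert b C) (R - {C})" "q \<in> insert (insert b C) (R - {C})" "p \<noteq> q"
  then show "disjnt p q"
    using R C b by (auto simp: partition_on_def disjoint_def disjnt_def)
qed

text \<open>Here \<open>C = {}\<close> encodes that the new element \<open>b\<close> forms a block of its own.\<close>

lemma sum_partition_on_insert_element:
  assumes Q: "finite Q" and b: "b \<notin> Q"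
  shows "(\<Sum>P | partition_on (insert b Q) P. f P) =
    (\<Sum>R | partition_on Q R. \<Sum>C\<in>insert {} R. f (insert (insert b C) (R - {C})))"
proof -
  let ?S = "SIGMA R:{R. partition_on Q R}. insert {} R"
  let ?h = "\<lambda>(R, C). insert (insert b C) (R - {C})"
  have fin: "finite {R. partition_on Q R}" "\<forall>R\<in>{R. partition_on Q R}. finite (insert {} R)"
    using Q finitely_many_partition_on finite_elements by auto
  \<comment> \<open>The block containing b reveals C; written as a union over all such blocks it is
    visibly a function of the new partition, which gives injectivity.\<close>
  have recover: "\<Union> {D \<in> ?h (R, C). b \<in> D} = insert b C"
    if "partition_on Q R" "C \<in> insert {} R" for R C
    using that b by (auto simp: partition_on_def)
  have notin: "b \<notin> C" if "partition_on Q R" "C \<in> insert {} R" for R C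
    using that b by (auto simp: partition_on_def)
  have rest: "(?h (R, C) - {insert b C}) \<union> ({C} - {{}}) = R"
    if "partition_on Q R" "C \<in> insert {} R" for R C
    using that b by (auto simp: partition_on_def)
  have "inj_on ?h ?S"
  proof (rule inj_onI)
    fix x x' assume x: "x \<in> ?S" "x' \<in> ?S" "?h x = ?h x'"
    obtain R C R' C' where eq: "x = (R, C)" "x' = (R', C')" by fastforce
    have RC: "partition_on Q R" "C \<in> insert {} R" "partition_on Q R'" "C' \<in> insert {} R'"
      using x unfolding eq by blast+
    have h: "?h (R, C) = ?h (R', C')"
      using x(3) unfolding eq .
    have "insert b C = insert b C'"
      using recover[OF RC(1,2)] recover[OF RC(3,4)] unfolding h by (rule trans[OF sym])
    then have CC: "C = C'"
      using insert_ident[of b C C'] notin[OF RC(1,2)] notin[OF RC(3,4)] by blast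
    have "R = R'"
      using rest[OF RC(1,2)] rest[OF RC(3,4)] unfolding h unfolding CC by (rule trans[OF sym])
    then show "x = x'"
      using CC eq by simp
  qed
  moreover have "?h ` ?S = {P. partition_on (insert b Q) P}"
  proof (intro equalityI subsetI)
    fix P assume "P \<in> ?h ` ?S"
    then obtain x where x: "P = ?h x" "x \<in> ?S"
      by (rule imageE)
    obtain R C where "x = (R, C)" by fastforce
    with x have "partition_on Q R" "C \<in> insert {} R" "P = ?h (R, C)"
      by simp_all
    then show "P \<in> {P. partition_on (insert b Q) P}"
      using partition_on_insert_element[OF _ _ b, of R C] by simp
  next
    fix P assume "P \<in> {P. partition_on (insert b Q) P}"
    then have P: "partition_on (insert b Q) P" by simp
    then obtain D where D: "D \<in> P" "b \<in> D"
      by (auto simp: partition_on_def)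
    \<comment> \<open>If b was alone in its block, then D - {b} is empty and must be dropped; this
      is the case encoded by C = {}.\<close>
    define R where "R = (P - {D}) \<union> ({D - {b}} - {{}})"
    have other: "b \<notin> E" if "E \<in> P" "E \<noteq> D" for E
      using partition_on_disjointD[OF P that(1) D(1) _ D(2)] that(2) by blast
    have disj: "E \<inter> F = {}" if "E \<in> P" "F \<in> P" "E \<noteq> F" for E F
      using disjointD[OF partition_onD2[OF P]] that by blast
    have part: "partition_on Q R"
    proof (rule partition_onI)
      show "\<Union> R = Q"
      proof -
        have "\<Union> R = \<Union> (P - {D}) \<union> (D - {b})"
          unfolding R_def by auto
        also have "\<dots> = \<Union> (insert D (P - {D})) - {b}"
          using other by auto
        also have "\<dots> = Q"
          unfolding insert_Diff[OF D(1)] partition_onD1[OF P, symmetric] using b by simp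
        finally show ?thesis .
      qed
      show "{} \<notin> R"
        using P by (auto simp: R_def partition_on_def)
      fix p q assume "p \<in> R" "q \<in> R" "p \<noteq> q"
      then consider "p \<in> P" "p \<noteq> D" "q \<in> P" "q \<noteq> D" | "p \<in> P" "p \<noteq> D" "q = D - {b}"
        | "q \<in> P" "q \<noteq> D" "p = D - {b}"
        unfolding R_def by blast
      then show "disjnt p q"
      proof cases
        case 1
        then show ?thesis using disj \<open>p \<noteq> q\<close> by (simp add: disjnt_def)
      next
        case 2
        then show ?thesis using disj[of p D] D by (auto simp: disjnt_def)
      next
        case 3
        then show ?thesis using disj[of q D] D by (auto simp: disjnt_def)
      qed
    qed
    have mem: "D - {b} \<in> insert {} R"
      by (auto simp: R_def)
    \<comment> \<open>Otherwise removing D - {b} from R would also remove a genuine block of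
      P.\<close>
    have "D - {b} \<notin> P - {D}"
    proof
      assume *: "D - {b} \<in> P - {D}"
      then have "D - {b} \<in> P" by blast
      then have "D - {b} \<noteq> {}"
        using partition_onD3[OF P] by metis
      then show False
        using * disj[of "D - {b}" D] D by auto
    qed
    moreover have "{} \<notin> P"
      by (rule partition_onD3[OF P])
    ultimately have "R - {D - {b}} = P - {D}"
      unfolding R_def by blast
    then have "P = ?h (R, D - {b})"
      by (simp only: prod.case insert_Diff[OF D(1)] insert_Diff[OF D(2)])
    moreover have "(R, D - {b}) \<in> ?S"
      using mem part by (intro SigmaI CollectI)
    ultimately show "P \<in> ?h ` ?S"
      by (rule image_eqI)
  qed
  ultimately have "(\<Sum>P | partition_on (insert b Q) P. f P) = (\<Sum>x\<in>?S. f (?h x))"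
    using sum.reindex[of ?h ?S f] by (simp only: o_def)
  also have "\<dots> = (\<Sum>R | partition_on Q R. \<Sum>C\<in>insert {} R. f (insert (insert b C) (R - {C})))"
    unfolding sum.Sigma[OF fin] by (intro sum.cong refl) (simp add: case_prod_unfold)
  finally show ?thesis .
qed

text \<open>Stated additively, because enlarging C by b may raise or lower the number of blocks with
  property q. That q fails for the empty set makes the encoding C = {} of a new block
  consistent.\<close>

lemma card_insert_element_blocks:
  assumes Q: "finite Q" and R: "partition_on Q R" and C: "C \<in> insert {} R" and b: "b \<notin> Q"
    and empty: "\<not> q {}"
  shows "card {D \<in> insert (insert b C) (R - {C}). q D} + of_bool (q C) =
    card {D \<in> R. q D} + of_bool (q (insert b C))"
proof -
  have finR: "finite R" using finite_elements[OF Q R] .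
  have new: "insert b C \<notin> R"
    using R b by (auto simp: partition_on_def)
  have "{D \<in> insert (insert b C) (R - {C}). q D} =
      {D \<in> R - {C}. q D} \<union> (if q (insert b C) then {insert b C} else {})"
    by auto
  then have 1: "card {D \<in> insert (insert b C) (R - {C}). q D} =
      card {D \<in> R - {C}. q D} + of_bool (q (insert b C))"
    using finR new by auto
  have 2: "card {D \<in> R. q D} = card {D \<in> R - {C}. q D} + of_bool (q C)"
  proof (cases "C \<in> R")
    case True
    then have "{D \<in> R. q D} = {D \<in> R - {C}. q D} \<union> (if q C then {C} else {})"
      by auto
    then show ?thesis using finR by auto
  next
    case False
    with C have "C = {}" by auto
    moreover have "{D \<in> R - {C}. q D} = {D \<in> R. q D}" using False by auto
    ultimately show ?thesis using empty by simp
  qed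
  show ?thesis unfolding 1 2 by simp
qed

lemma card_insert_element:
  assumes "finite Q" "partition_on Q R" "C \<in> insert {} R" "b \<notin> Q"
  shows "card (insert (insert b C) (R - {C})) = card R + of_bool (C = {})"
proof -
  let ?P = "insert (insert b C) (R - {C})"
  have "{D \<in> ?P. D \<noteq> {}} = ?P" "{D \<in> R. D \<noteq> {}} = R"
    using partition_onD3[OF assms(2)] by auto
  then show ?thesis
    using card_insert_element_blocks[OF assms, of "\<lambda>D. D \<noteq> {}"] by (cases "C = {}") auto
qed

section \<open>Weighted sums over the partitions of a finite set\<close>

definition meeting :: "'a set set \<Rightarrow> 'a set \<Rightarrow> 'a set set" where
  "meeting R A = {D \<in> R. D \<inter> A \<noteq> {}}"

text \<open>The points stand for the blocks of the join, A and B for the through classes of the two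
  diagrams lifted to it, and R for a coarsening. The value is the corresponding entry of G', or 0 if
  through classes have merged.\<close>

definition partition_weight :: "'b::comm_ring_1 \<Rightarrow> nat \<Rightarrow> 'a set \<Rightarrow> 'a set \<Rightarrow> 'a set set \<Rightarrow> 'b" where
  "partition_weight y s A B R =
    (if card (meeting R A) = s \<and> card (meeting R B) = s
     then gram_weight y (card R - s) (card (meeting R A - meeting R B)) else 0)"

lemma card_meeting_le:
  assumes "partition_on Q R" "finite A"
  shows "card (meeting R A) \<le> card A"
proof -
  have "\<forall>D\<in>meeting R A. \<exists>x. x \<in> D \<and> x \<in> A"
    by (auto simp: meeting_def)
  then obtain f where f: "\<And>D. D \<in> meeting R A \<Longrightarrow> f D \<in> D \<and> f D \<in> A"
    by metis
  have "inj_on f (meeting R A)"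
  proof (rule inj_onI)
    fix C D assume *: "C \<in> meeting R A" "D \<in> meeting R A" "f C = f D"
    then have "C \<in> R" "D \<in> R" "f C \<in> C" "f C \<in> D"
      using f[of C] f[of D] by (auto simp: meeting_def)
    then show "C = D" by (rule partition_on_disjointD[OF assms(1)])
  qed
  then show ?thesis
    using f assms(2) by (intro card_inj_on_le[of f]) auto
qed

lemma partition_on_blocks_singletons:
  assumes "finite A" "partition_on A R" "card R = card A"
  shows "R = (\<lambda>x. {x}) ` A"
proof -
  have ne: "D \<noteq> {}" "finite D" if "D \<in> R" for D
    using assms that by (auto simp: partition_on_def intro: finite_subset)
  have finR: "finite R" using assms finite_elements by blast
  have "card A = (\<Sum>D\<in>R. card D)"
    using product_partition[OF assms(2)] ne by simp
  \<comment> \<open>The natural number subtraction is exact because all blocks are nonempty.\<close>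
  then have "(\<Sum>D\<in>R. card D - 1) = 0"
    using ne assms(3) by (subst sum_subtractf_nat) (auto simp: Suc_le_eq card_gt_0_iff)
  then have "card D \<le> 1" if "D \<in> R" for D
    using that finR by simp
  moreover have "card D > 0" if "D \<in> R" for D
    using ne[OF that] by (simp add: card_gt_0_iff)
  ultimately have card1: "card D = 1" if "D \<in> R" for D
    using that by (simp add: le_antisym Suc_leI)
  show ?thesis
  proof (intro equalityI subsetI)
    fix D assume D: "D \<in> R"
    then obtain x where "D = {x}" using card1 card_1_singletonE by blast
    then show "D \<in> (\<lambda>x. {x}) ` A" using D assms by (auto simp: partition_on_def)
  next
    fix D assume "D \<in> (\<lambda>x. {x}) ` A"
    then obtain x E where "D = {x}" "E \<in> R" "x \<in> E" using assms by (auto simp: partition_on_def)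
    then show "D \<in> R" using card1[of E] by (auto simp: card_1_singleton_iff)
  qed
qed

lemma meeting_self_eq: "partition_on A R \<Longrightarrow> meeting R A = R"
proof -
  assume R: "partition_on A R"
  have "D \<inter> A = D" "D \<noteq> {}" if "D \<in> R" for D
    using R that by (auto simp: partition_on_def)
  then show ?thesis by (auto simp: meeting_def)
qed

text \<open>Without further points only the partition of A into singletons keeps s blocks, and its
  weight is 1. A point added outside A keeps the weight in each of the \<open>card R\<close>
  existing blocks and multiplies it by y - (card R - s) as a block of its own; the total y + s does
  not depend on R.\<close>

lemma sum_partition_weight_same:
  assumes "finite E" "finite A" "A \<inter> E = {}" "card A = s"
  shows "(\<Sum>R | partition_on (A \<union> E) R. partition_weight y s A A R) = (y + of_nat s) ^ card E"
  using assms
proof (induction E)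
  case empty
  have "(\<Sum>R | partition_on A R. partition_weight y s A A R) =
      (\<Sum>R\<in>{(\<lambda>x. {x}) ` A}. partition_weight y s A A R)"
    using empty partition_on_blocks_singletons[of A] finitely_many_partition_on[of A]
    by (intro sum.mono_neutral_right)
      (auto simp: partition_on_singletons partition_weight_def meeting_self_eq)
  also have "\<dots> = 1"
    using empty partition_on_singletons[of A]
    by (simp add: partition_weight_def meeting_self_eq card_image gram_weight_def)
  finally show ?case by simp
next
  case (insert b E)
  let ?Q = "A \<union> E" and ?w = "partition_weight y s A A"
  have b: "b \<notin> ?Q" "finite ?Q" "b \<notin> A" using insert by auto
  have step: "(\<Sum>C\<in>insert {} R. ?w (insert (insert b C) (R - {C}))) = (y + of_nat s) * ?w R"
    if R: "partition_on ?Q R" for R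
  proof -
    have finR: "finite R" using finite_elements[OF b(2) R] .
    have meet: "card (meeting (insert (insert b C) (R - {C})) A) = card (meeting R A)"
      if "C \<in> insert {} R" for C
      using card_insert_element_blocks[OF b(2) R that b(1), of "\<lambda>D. D \<inter> A \<noteq> {}"] b(3)
      by (simp add: meeting_def)
    note cardC = card_insert_element[OF b(2) R _ b(1)]
    show ?thesis
    proof (cases "card (meeting R A) = s")
      case False
      then show ?thesis by (simp add: partition_weight_def meet)
    next
      case True
      have le: "s \<le> card R"
        using True finR card_mono[of R "meeting R A"] by (auto simp: meeting_def)
      let ?g = "gram_weight y (card R - s) 0"
      have "(\<Sum>C\<in>insert {} R. ?w (insert (insert b C) (R - {C}))) =
          (\<Sum>C\<in>insert {} R. gram_weight y (card R + of_bool (C = {}) - s) 0)"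
        by (intro sum.cong refl) (simp add: partition_weight_def meet cardC True)
      also have "\<dots> = gram_weight y (Suc (card R - s)) 0 + (\<Sum>C\<in>R. gram_weight y (card R + of_bool (C = {}) - s) 0)"
        using finR R le by (subst sum.insert) (auto simp: partition_on_def Suc_diff_le)
      also have "(\<Sum>C\<in>R. gram_weight y (card R + of_bool (C = {}) - s) 0) = (\<Sum>C\<in>R. ?g)"
        using R by (intro sum.cong refl) (auto simp: partition_on_def)
      also have "gram_weight y (Suc (card R - s)) 0 + (\<Sum>C\<in>R. ?g) = (y + of_nat s) * ?g"
        using le by (simp add: gram_weight_Suc of_nat_diff algebra_simps)
      finally show ?thesis
        by (simp add: partition_weight_def True)
    qed
  qed
  have "(\<Sum>R | partition_on (A \<union> insert b E) R. ?w R) =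
      (\<Sum>R | partition_on ?Q R. (y + of_nat s) * ?w R)"
    using sum_partition_on_insert_element[OF b(2,1), of ?w] step by simp
  also have "\<dots> = (y + of_nat s) ^ card (insert b E)"
    using insert by (simp add: sum_distrib_left[symmetric])
  finally show ?case .
qed

text \<open>The cancellation behind the case of different through classes: t places next to a class
  of A alone, r + 1 - t places in a block meeting neither set, and one new block.\<close>

lemma gram_weight_cancel:
  assumes "t > 0" "t \<le> Suc r"
  shows "of_nat t * gram_weight y r (t - 1) + (of_nat (Suc r) - of_nat t) * gram_weight y r t +
    gram_weight y (Suc r) t = 0"
proof -
  obtain t' where t: "t = Suc t'" using assms gr0_implies_Suc by blast
  show ?thesis
  proof (cases "t \<le> r")
    case True
    define p where "p = (-1) ^ t' * of_nat (fact t') * (\<Prod>m\<in>{t..<r}. y - of_nat m)"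
    have "{t'..<r} = insert t' {t..<r}"
      using True t by auto
    then have low: "gram_weight y r (t - 1) = (y - of_nat t') * p"
      unfolding gram_weight_def p_def t by (simp add: mult_ac)
    have mid: "gram_weight y r t = - of_nat t * p"
      unfolding gram_weight_def p_def t by (simp add: algebra_simps)
    show ?thesis
      unfolding gram_weight_Suc[OF True] low mid by (simp add: t algebra_simps)
  next
    \<comment> \<open>Here t = r + 1: the middle coefficient is 0, and the products in the other two
      terms are empty.\<close>
    case False
    then have "r = t'" using assms t by simp
    then show ?thesis by (simp add: t gram_weight_def algebra_simps)
  qed
qed

text \<open>An element \<open>b\<close> of \<open>B - A\<close> may join a block meeting only \<open>A\<close>, or a block meeting neither set,
  or form a new block; the three contributions cancel.\<close>

lemma sum_partition_weight_distinct:
  assumes Q: "finite Q" and AB: "A \<subseteq> Q" "B \<subseteq> Q" "card A = s" "card B = s" "A \<noteq> B"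
  shows "(\<Sum>R | partition_on Q R. partition_weight y s A B R) = 0"
proof -
  have finAB: "finite A" "finite B" using AB Q finite_subset by auto
  have "\<not> B \<subseteq> A"
    using AB finAB card_subset_eq[of A B] by auto
  then obtain b where bB: "b \<in> B" "b \<notin> A" by blast
  define Q' where "Q' = Q - {b}"
  have b: "b \<notin> Q'" "finite Q'" "Q = insert b Q'" using bB AB Q by (auto simp: Q'_def)
  let ?w = "partition_weight y s A B"
  have "(\<Sum>C\<in>insert {} R. ?w (insert (insert b C) (R - {C}))) = 0" if R: "partition_on Q' R" for R
  proof -
    let ?P = "\<lambda>C. insert (insert b C) (R - {C})"
    have finR: "finite R" using finite_elements[OF b(2) R] .
    have bD: "b \<notin> D" if "D \<in> insert {} R" for D
      using that R b by (auto simp: partition_on_def)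
    \<comment> \<open>Before b is inserted only s - 1 points of B are present, so fewer than s
      blocks meet B.\<close>
    have "meeting R B = meeting R (B - {b})"
      using bD by (auto simp: meeting_def)
    then have hB: "card (meeting R B) < s"
      using card_meeting_le[OF R, of "B - {b}"] finAB bB AB card_gt_0_iff[of B] by auto
    have cA: "card (meeting (?P C) A) = card (meeting R A)" if "C \<in> insert {} R" for C
      using card_insert_element_blocks[OF b(2) R that b(1), of "\<lambda>D. D \<inter> A \<noteq> {}"] bB
      by (simp add: meeting_def)
    have cB: "card (meeting (?P C) B) = card (meeting R B) + of_bool (C \<inter> B = {})" if "C \<in> insert {} R" for C
      using card_insert_element_blocks[OF b(2) R that b(1), of "\<lambda>D. D \<inter> B \<noteq> {}"] bB
      by (cases "C \<inter> B = {}") (auto simp: meeting_def)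
    have diff: "meeting S A - meeting S B = {D \<in> S. D \<inter> A \<noteq> {} \<and> D \<inter> B = {}}" for S
      by (auto simp: meeting_def)
    have cAB: "card (meeting (?P C) A - meeting (?P C) B) + of_bool (C \<inter> A \<noteq> {} \<and> C \<inter> B = {}) =
        card (meeting R A - meeting R B)" if "C \<in> insert {} R" for C
      using card_insert_element_blocks[OF b(2) R that b(1), of "\<lambda>D. D \<inter> A \<noteq> {} \<and> D \<inter> B = {}"] bB
      by (simp add: diff)
    show ?thesis
    \<comment> \<open>Inserting b leaves the number of blocks meeting A unchanged and adds at most
      one block meeting B. Outside this case every term has weight 0.\<close>
    proof (cases "card (meeting R A) = s \<and> Suc (card (meeting R B)) = s")
      case False
      have "?w (?P C) = 0" if "C \<in> insert {} R" for C
        using False hB cA[OF that] cB[OF that] by (auto simp: partition_weight_def)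
      then show ?thesis by (simp del: sum.insert)
    next
      case True
      define t where "t = card (meeting R A - meeting R B)"
      define r where "r = card R - s"
      have fin: "finite (meeting R A)" "finite (meeting R B)"
        using finR by (auto simp: meeting_def)
      have le: "s \<le> card R"
        using True finR card_mono[of R "meeting R A"] by (auto simp: meeting_def)
      have t0: "t > 0"
      proof (rule ccontr)
        assume "\<not> t > 0"
        then have "meeting R A \<subseteq> meeting R B" using fin by (simp add: t_def)
        then have "card (meeting R A) \<le> card (meeting R B)" by (rule card_mono[OF fin(2)])
        then show False using True by linarith
      qed
      have union: "card (meeting R A \<union> meeting R B) = t + card (meeting R B)"
        unfolding t_def using fin by (subst card_Un_disjoint[symmetric]) auto
      have Un: "meeting R A \<union> meeting R B \<subseteq> R" by (auto simp: meeting_def)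
      have tr: "t \<le> Suc r"
        using union card_mono[OF finR Un] True le unfolding r_def by linarith
      \<comment> \<open>The blocks meeting neither set. The blocks meeting B contribute nothing
        below: b in one of them leaves their number at s - 1.\<close>
      define U where "U = R - (meeting R A \<union> meeting R B)"
      have cU: "card U = Suc r - t"
        unfolding U_def card_Diff_subset[OF finite_UnI[OF fin] Un] union using True le
        unfolding r_def by linarith
      have w0: "?w (?P {}) = gram_weight y (Suc r) t"
        using cA[of "{}"] cB[of "{}"] cAB[of "{}"] True le card_insert_element[OF b(2) R _ b(1), of "{}"]
        by (simp add: partition_weight_def t_def r_def Suc_diff_le)
      have wA: "?w (?P C) = gram_weight y r (t - 1)" if "C \<in> meeting R A - meeting R B" for C
      proof -
        have C: "C \<in> insert {} R" "C \<noteq> {}" "C \<inter> A \<noteq> {}" "C \<inter> B = {}" using that by (auto simp: meeting_def)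
        have "card (meeting (?P C) A - meeting (?P C) B) = card (meeting R A - meeting R B) - 1"
          using cAB[OF C(1)] C by simp
        then show ?thesis
          using cA[OF C(1)] cB[OF C(1)] C True card_insert_element[OF b(2) R C(1) b(1)]
          by (simp add: partition_weight_def t_def r_def)
      qed
      have wU: "?w (?P C) = gram_weight y r t" if "C \<in> U" for C
      proof -
        have C: "C \<in> insert {} R" "C \<noteq> {}" "C \<inter> A = {}" "C \<inter> B = {}"
          using that R by (auto simp: meeting_def U_def partition_on_def)
        then show ?thesis
          using cA[OF C(1)] cB[OF C(1)] cAB[OF C(1)] True card_insert_element[OF b(2) R C(1) b(1)]
          by (simp add: partition_weight_def t_def r_def)
      qed
      have wB: "?w (?P C) = 0" if "C \<in> meeting R B" for C
      proof -
        have C: "C \<in> insert {} R" "C \<inter> B \<noteq> {}" using that by (auto simp: meeting_def)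
        then show ?thesis
          using cB[OF C(1)] True by (simp add: partition_weight_def)
      qed
      have R_split: "R = ((meeting R A - meeting R B) \<union> U) \<union> meeting R B"
        by (auto simp: U_def meeting_def)
      have finU: "finite U" using finR by (simp add: U_def)
      have "(\<Sum>C\<in>R. ?w (?P C)) = (\<Sum>C\<in>(meeting R A - meeting R B) \<union> U. ?w (?P C)) + (\<Sum>C\<in>meeting R B. ?w (?P C))"
        using fin finU by (subst (1) R_split, intro sum.union_disjoint) (blast | simp add: U_def)+
      also have "(\<Sum>C\<in>(meeting R A - meeting R B) \<union> U. ?w (?P C)) =
          (\<Sum>C\<in>meeting R A - meeting R B. ?w (?P C)) + (\<Sum>C\<in>U. ?w (?P C))"
        using fin finU by (intro sum.union_disjoint) (blast | simp add: U_def)+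
      finally have sumR: "(\<Sum>C\<in>R. ?w (?P C)) =
          of_nat t * gram_weight y r (t - 1) + of_nat (Suc r - t) * gram_weight y r t"
        by (simp add: wA wU wB t_def[symmetric] cU)
      have "(\<Sum>C\<in>insert {} R. ?w (?P C)) = ?w (?P {}) + (\<Sum>C\<in>R. ?w (?P C))"
        using finR partition_onD3[OF R] by (intro sum.insert)
      also have "\<dots> = of_nat t * gram_weight y r (t - 1) +
          (of_nat (Suc r) - of_nat t) * gram_weight y r t + gram_weight y (Suc r) t"
        unfolding w0 sumR of_nat_diff[OF tr] by (simp only: ac_simps)
      also have "\<dots> = 0"
        by (rule gram_weight_cancel[OF t0 tr])
      finally show ?thesis .
    qed
  qed
  then show ?thesis
    unfolding b(3) sum_partition_on_insert_element[OF b(2,1)] by simp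
qed

section \<open>Equivalence classes generated by a family of blocks\<close>

definition generated_rel :: "'a set set \<Rightarrow> ('a \<times> 'a) set" where
  "generated_rel P = (\<Union>B\<in>P. B \<times> B)"

text \<open>Every point of V lies in some block, so the generating relation is reflexive on V and
  symmetric, and its transitive closure is an equivalence.\<close>

lemma partition_on_quotient_trancl:
  assumes "\<Union>P = V"
  shows "equiv V ((generated_rel P)\<^sup>+)" "partition_on V (V // (generated_rel P)\<^sup>+)"
proof -
  have "generated_rel P \<subseteq> V \<times> V"
    using assms by (auto simp: generated_rel_def)
  then have sub: "(generated_rel P)\<^sup>+ \<subseteq> V \<times> V"
    by (rule trancl_subset_Sigma)
  have "refl_on V ((generated_rel P)\<^sup>+)"
    using assms by (auto simp: refl_on_def generated_rel_def)
  moreover have "sym ((generated_rel P)\<^sup>+)"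
    by (rule sym_trancl) (auto simp: sym_def generated_rel_def)
  ultimately show eq: "equiv V ((generated_rel P)\<^sup>+)"
    using sub by (simp add: equiv_def)
  show "partition_on V (V // (generated_rel P)\<^sup>+)"
    using eq by (rule partition_on_quotient)
qed

lemma trancl_generated_rel_mem_block:
  assumes S: "partition_on V S" and fine: "\<And>B. B \<in> P \<Longrightarrow> \<exists>C\<in>S. B \<subseteq> C"
    and "(x, y) \<in> (generated_rel P)\<^sup>+" and C: "C \<in> S" "x \<in> C"
  shows "y \<in> C"
  using assms(3)
proof (induction rule: trancl_induct)
  case (base y)
  then obtain B where B: "B \<in> P" "x \<in> B" "y \<in> B" by (auto simp: generated_rel_def)
  then obtain C' where "C' \<in> S" "B \<subseteq> C'" using fine by blast
  then show ?case using B C partition_on_disjointD[OF S, of C C' x] by auto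
next
  case (step y z)
  then obtain B where B: "B \<in> P" "y \<in> B" "z \<in> B" by (auto simp: generated_rel_def)
  then obtain C' where "C' \<in> S" "B \<subseteq> C'" using fine by blast
  then show ?case using B C step partition_on_disjointD[OF S, of C C' y] by auto
qed

text \<open>A criterion for connected components: fineness keeps each class inside a single block of
  S, connectedness makes it fill that block.\<close>

lemma quotient_trancl_eqI:
  assumes S: "partition_on V S" and fine: "\<And>B. B \<in> P \<Longrightarrow> \<exists>C\<in>S. B \<subseteq> C"
    and conn: "\<And>C x y. C \<in> S \<Longrightarrow> x \<in> C \<Longrightarrow> y \<in> C \<Longrightarrow> (x, y) \<in> (generated_rel P)\<^sup>+"
  shows "V // (generated_rel P)\<^sup>+ = S"
proof -
  have block: "(generated_rel P)\<^sup>+ `` {x} = C" if "C \<in> S" "x \<in> C" for x C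
  proof (intro equalityI subsetI)
    fix y assume "y \<in> (generated_rel P)\<^sup>+ `` {x}"
    then have "(x, y) \<in> (generated_rel P)\<^sup>+" by simp
    then show "y \<in> C" using trancl_generated_rel_mem_block[OF S fine _ that] by blast
  next
    fix y assume "y \<in> C"
    then show "y \<in> (generated_rel P)\<^sup>+ `` {x}" using conn[OF that] by simp
  qed
  have V: "V = \<Union>S" using partition_onD1[OF S] .
  show ?thesis
  proof (intro equalityI subsetI)
    fix C assume "C \<in> V // (generated_rel P)\<^sup>+"
    then obtain x where "x \<in> V" "C = (generated_rel P)\<^sup>+ `` {x}" by (rule quotientE)
    moreover from this obtain D where "D \<in> S" "x \<in> D" using V by blast
    ultimately show "C \<in> S" using block[of D x] by simp
  next
    fix C assume C: "C \<in> S"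
    then have "C \<noteq> {}" using partition_onD3[OF S] by auto
    then obtain x where x: "x \<in> C" by blast
    then have "x \<in> V" using C V by blast
    then show "C \<in> V // (generated_rel P)\<^sup>+"
      using quotientI[of x V "(generated_rel P)\<^sup>+"] unfolding block[OF C x] by simp
  qed
qed

section \<open>Through classes of a coarsening\<close>

definition lift_classes :: "'a set set \<Rightarrow> 'a set set \<Rightarrow> 'a set set" where
  "lift_classes M \<rho> = {C \<in> \<rho>. \<exists>B\<in>M. B \<subseteq> C}"

lemma lift_classes_self:
  assumes "partition_on V \<pi>" "M \<subseteq> \<pi>"
  shows "lift_classes M \<pi> = M"
proof -
  have "C = B" if "C \<in> \<pi>" "B \<in> M" "B \<subseteq> C" for B C
  proof -
    have "B \<in> \<pi>" "B \<noteq> {}" using that assms partition_onD3[OF assms(1)] by auto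
    then show ?thesis using that partition_on_disjointD[OF assms(1), of C B] by blast
  qed
  then show ?thesis using assms(2) by (auto simp: lift_classes_def)
qed

text \<open>Each lifted class contains a member of M, and disjoint classes contain different
  nonempty members: coarsening can merge through classes but not create them.\<close>

lemma card_lift_classes_le:
  assumes "partition_on V \<rho>" "finite M" "{} \<notin> M"
  shows "card (lift_classes M \<rho>) \<le> card M"
proof -
  have "\<forall>C\<in>lift_classes M \<rho>. \<exists>B. B \<in> M \<and> B \<subseteq> C"
    by (auto simp: lift_classes_def)
  then obtain f where f: "\<And>C. C \<in> lift_classes M \<rho> \<Longrightarrow> f C \<in> M \<and> f C \<subseteq> C"
    by metis
  have "inj_on f (lift_classes M \<rho>)"
  proof (rule inj_onI)
    fix C D assume *: "C \<in> lift_classes M \<rho>" "D \<in> lift_classes M \<rho>" "f C = f D"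
    then have "f C \<noteq> {}" using f[of C] assms(3) by auto
    then obtain x where "x \<in> f C" by blast
    then have "x \<in> C" "x \<in> D" using f[of C] f[of D] * by auto
    moreover have "C \<in> \<rho>" "D \<in> \<rho>" using * by (auto simp: lift_classes_def)
    ultimately show "C = D"
      using partition_on_disjointD[OF assms(1)] by blast
  qed
  then show ?thesis
    using f assms(2) by (intro card_inj_on_le[of f]) auto
qed

text \<open>Blocks are nonempty and disjoint, so a union of blocks determines which blocks were
  used. Thus \<open>Union\<close> preserves the cardinalities that enter the weights.\<close>

lemma partition_on_Union_Pow_inj:
  assumes "partition_on V \<sigma>"
  shows "inj_on Union (Pow \<sigma>)"
proof (rule inj_onI)
  have sub: "K \<subseteq> L" if "K \<subseteq> \<sigma>" "L \<subseteq> \<sigma>" "\<Union>K = \<Union>L" for K L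
  proof
    fix C assume C: "C \<in> K"
    then have "C \<noteq> {}" using that(1) partition_onD3[OF assms] by auto
    then obtain x where x: "x \<in> C" by blast
    then have "x \<in> \<Union>L" unfolding that(3)[symmetric] using C by blast
    then obtain D where D: "D \<in> L" "x \<in> D" by blast
    then have "C = D" using that C x partition_on_disjointD[OF assms, of C D x] by auto
    then show "C \<in> L" using D by simp
  qed
  fix K L assume "K \<in> Pow \<sigma>" "L \<in> Pow \<sigma>" "\<Union>K = \<Union>L"
  then show "K = L" using sub[of K L] sub[of L K] by auto
qed

text \<open>A coarsening of \<sigma> amounts to a partition of the set \<sigma> of blocks; the
  inverse sends a coarse block D to the set of blocks inside D. The sum over coarsenings thereby
  becomes one over the partitions of a finite set, from which points can be removed singly.\<close>

lemma bij_betw_partitions_coarsenings: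
  assumes \<sigma>: "partition_on V \<sigma>"
  shows "bij_betw ((`) Union) {R. partition_on \<sigma> R} {\<rho>. refines V \<sigma> \<rho>}"
  unfolding bij_betw_def
proof (intro conjI equalityI subsetI)
  have "\<Union> {R. partition_on \<sigma> R} \<subseteq> Pow \<sigma>" by (auto simp: partition_on_def)
  then show "inj_on ((`) Union) {R. partition_on \<sigma> R}"
    using partition_on_Union_Pow_inj[OF \<sigma>] inj_on_subset by (intro inj_on_image) blast
next
  fix \<rho> assume "\<rho> \<in> (`) Union ` {R. partition_on \<sigma> R}"
  then obtain R where R: "partition_on \<sigma> R" "\<rho> = Union ` R" by blast
  have "partition_on V \<rho>"
  proof (rule partition_onI)
    show "\<Union>\<rho> = V"
      using partition_onD1[OF \<sigma>] partition_onD1[OF R(1)] R(2) by auto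
    show "{} \<notin> \<rho>"
    proof
      assume "{} \<in> \<rho>"
      then obtain D where D: "D \<in> R" "\<Union>D = {}" using R(2) by auto
      moreover have "D \<noteq> {}" using D partition_onD3[OF R(1)] by auto
      then obtain C where "C \<in> D" by blast
      moreover from this have "C \<in> \<sigma>" using D partition_onD1[OF R(1)] by blast
      ultimately show False using partition_onD3[OF \<sigma>] by auto
    qed
    fix p q assume "p \<in> \<rho>" "q \<in> \<rho>" "p \<noteq> q"
    then obtain D E where DE: "D \<in> R" "E \<in> R" "p = \<Union>D" "q = \<Union>E" "D \<noteq> E" using R(2) by auto
    show "disjnt p q"
      unfolding disjnt_iff
    proof clarify
      fix x assume "x \<in> p" "x \<in> q"
      then obtain C C' where C: "C \<in> D" "C' \<in> E" "x \<in> C" "x \<in> C'" using DE by auto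
      then have "C \<in> \<sigma>" "C' \<in> \<sigma>" using DE partition_onD1[OF R(1)] by auto
      then have "C = C'" using C partition_on_disjointD[OF \<sigma>] by blast
      then show False using C DE partition_on_disjointD[OF R(1), of D E C] by auto
    qed
  qed
  moreover have "\<exists>L\<in>\<rho>. K \<subseteq> L" if "K \<in> \<sigma>" for K
    using that R partition_onD1[OF R(1)] by auto
  ultimately show "\<rho> \<in> {\<rho>. refines V \<sigma> \<rho>}"
    using \<sigma> by (simp add: refines_def)
next
  fix \<rho> assume "\<rho> \<in> {\<rho>. refines V \<sigma> \<rho>}"
  then have ref: "refines V \<sigma> \<rho>" and \<rho>: "partition_on V \<rho>" by (auto simp: refines_def)
  define R where "R = (\<lambda>D. {C \<in> \<sigma>. C \<subseteq> D}) ` \<rho>"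
  have Un: "\<Union> {C \<in> \<sigma>. C \<subseteq> D} = D" if "D \<in> \<rho>" for D
    using partition_onD1[OF refines_obtains_subset[OF ref that]] by simp
  have "partition_on \<sigma> R"
  proof (rule partition_onI)
    show "\<Union>R = \<sigma>"
      using ref by (auto simp: R_def refines_def)
    have "{C \<in> \<sigma>. C \<subseteq> D} \<noteq> {}" if "D \<in> \<rho>" for D
    proof
      assume "{C \<in> \<sigma>. C \<subseteq> D} = {}"
      then have "D = {}" using Un[OF that] by (simp only: Union_empty)
      then show False using that partition_onD3[OF \<rho>] by simp
    qed
    then show "{} \<notin> R" by (auto simp: R_def)
    fix p q assume "p \<in> R" "q \<in> R" "p \<noteq> q"
    then obtain D E where "D \<in> \<rho>" "E \<in> \<rho>" "p = {C \<in> \<sigma>. C \<subseteq> D}" "q = {C \<in> \<sigma>. C \<subseteq> E}"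
      unfolding R_def by blast
    moreover from this have "D \<noteq> E" using \<open>p \<noteq> q\<close> by blast
    ultimately have DE: "D \<in> \<rho>" "E \<in> \<rho>" "D \<noteq> E" "p = {C \<in> \<sigma>. C \<subseteq> D}" "q = {C \<in> \<sigma>. C \<subseteq> E}"
      by blast+
    show "disjnt p q"
      unfolding disjnt_iff
    proof clarify
      fix C assume "C \<in> p" "C \<in> q"
      then have C: "C \<in> \<sigma>" "C \<subseteq> D" "C \<subseteq> E" using DE by auto
      then have "C \<noteq> {}" using partition_onD3[OF \<sigma>] by auto
      then obtain x where "x \<in> C" by blast
      then show False using C DE partition_on_disjointD[OF \<rho>, of D E x] by auto
    qed
  qed
  moreover have "\<rho> = Union ` R"
    using Un by (force simp: R_def image_image)
  ultimately show "\<rho> \<in> (`) Union ` {R. partition_on \<sigma> R}" by blast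
qed

text \<open>A nonempty B \<in> M lies in exactly one block of \<sigma>, so it is contained in a
  union of blocks iff that block is among them. This translates lifting into
  \<open>meeting\<close>.\<close>

lemma lift_classes_Union_image:
  assumes \<sigma>: "partition_on V \<sigma>" and R: "partition_on \<sigma> R"
    and M: "{} \<notin> M" "\<And>B. B \<in> M \<Longrightarrow> \<exists>C\<in>\<sigma>. B \<subseteq> C"
  shows "lift_classes M (Union ` R) = Union ` meeting R (lift_classes M \<sigma>)"
proof -
  have "(\<exists>B\<in>M. B \<subseteq> \<Union>D) \<longleftrightarrow> D \<inter> lift_classes M \<sigma> \<noteq> {}" if "D \<in> R" for D
  proof
    have D: "D \<subseteq> \<sigma>" using that partition_onD1[OF R] by auto
    assume "\<exists>B\<in>M. B \<subseteq> \<Union>D"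
    then obtain B where B: "B \<in> M" "B \<subseteq> \<Union>D" by blast
    then obtain C where C: "C \<in> \<sigma>" "B \<subseteq> C" using M by blast
    from B have "B \<noteq> {}" using M by auto
    then obtain x where x: "x \<in> B" by blast
    then obtain C' where C': "C' \<in> D" "x \<in> C'" using B by blast
    then have "C = C'" using C D x partition_on_disjointD[OF \<sigma>, of C C' x] by blast
    then show "D \<inter> lift_classes M \<sigma> \<noteq> {}" using B C C' by (auto simp: lift_classes_def)
  next
    assume "D \<inter> lift_classes M \<sigma> \<noteq> {}"
    then show "\<exists>B\<in>M. B \<subseteq> \<Union>D" by (auto simp: lift_classes_def)
  qed
  then have "meeting R (lift_classes M \<sigma>) = {D \<in> R. \<exists>B\<in>M. B \<subseteq> \<Union>D}"
    unfolding meeting_def by auto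
  then show ?thesis
    unfolding lift_classes_def[of M "Union ` R"] by auto
qed

definition coarsening_weight :: "'b::comm_ring_1 \<Rightarrow> nat \<Rightarrow> 'a set set \<Rightarrow> 'a set set \<Rightarrow> 'a set set \<Rightarrow> 'b" where
  "coarsening_weight y s M M' \<rho> =
    (if card (lift_classes M \<rho>) = s \<and> card (lift_classes M' \<rho>) = s
     then gram_weight y (card \<rho> - s) (card (lift_classes M \<rho> - lift_classes M' \<rho>)) else 0)"

lemma sum_coarsening_weight_eq:
  assumes \<sigma>: "partition_on V \<sigma>"
    and M: "{} \<notin> M" "\<And>B. B \<in> M \<Longrightarrow> \<exists>C\<in>\<sigma>. B \<subseteq> C"
    and M': "{} \<notin> M'" "\<And>B. B \<in> M' \<Longrightarrow> \<exists>C\<in>\<sigma>. B \<subseteq> C"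
  shows "(\<Sum>\<rho> | refines V \<sigma> \<rho>. coarsening_weight y s M M' \<rho>) =
    (\<Sum>R | partition_on \<sigma> R. partition_weight y s (lift_classes M \<sigma>) (lift_classes M' \<sigma>) R)"
proof -
  have "coarsening_weight y s M M' (Union ` R) =
      partition_weight y s (lift_classes M \<sigma>) (lift_classes M' \<sigma>) R" if R: "partition_on \<sigma> R" for R
  proof -
    have "R \<subseteq> Pow \<sigma>" using partition_onD1[OF R] by auto
    then have inj: "inj_on Union R"
      using partition_on_Union_Pow_inj[OF \<sigma>] inj_on_subset by blast
    have sub: "meeting R K \<subseteq> R" for K by (auto simp: meeting_def)
    have card: "card (Union ` Z) = card Z" if "Z \<subseteq> R" for Z
      using inj_on_subset[OF inj that] by (rule card_image)
    have diff: "Union ` meeting R K - Union ` meeting R L = Union ` (meeting R K - meeting R L)" for K L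
      by (rule inj_on_image_set_diff[OF inj, symmetric]) (use sub in blast)+
    have card_diff: "card (Union ` (meeting R K - meeting R L)) = card (meeting R K - meeting R L)" for K L
      by (rule card) (use sub in blast)
    have lift: "lift_classes M (Union ` R) = Union ` meeting R (lift_classes M \<sigma>)"
      "lift_classes M' (Union ` R) = Union ` meeting R (lift_classes M' \<sigma>)"
      using M M' by (auto intro!: lift_classes_Union_image[OF \<sigma> R])
    show ?thesis
      unfolding coarsening_weight_def partition_weight_def lift diff card[OF sub] card[OF order_refl] card_diff
      by (rule refl)
  qed
  then show ?thesis
    using sum.reindex_bij_betw[OF bij_betw_partitions_coarsenings[OF \<sigma>], of "coarsening_weight y s M M'"]
    by simp
qed

text \<open>A or B may have fewer than s points when through classes merge already in the join; then
  every weight is 0. If both have s points, \<open>card (A \<inter> B) = s\<close> just says A =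
  B.\<close>

lemma sum_partition_weight_eq:
  assumes "finite Q" "A \<subseteq> Q" "B \<subseteq> Q" "card A \<le> s" "card B \<le> s"
  shows "(\<Sum>R | partition_on Q R. partition_weight y s A B R) =
    (if card (A \<inter> B) = s then (y + of_nat s) ^ card (Q - (A \<union> B)) else 0)"
proof -
  have fin: "finite A" "finite B" using assms finite_subset by auto
  show ?thesis
  proof (cases "card A = s \<and> card B = s")
    case False
    have "partition_weight y s A B R = 0" if "partition_on Q R" for R
      using False assms card_meeting_le[OF that fin(1)] card_meeting_le[OF that fin(2)]
      by (auto simp: partition_weight_def)
    moreover have "card (A \<inter> B) \<noteq> s"
      using False assms card_mono[OF fin(1), of "A \<inter> B"] card_mono[OF fin(2), of "A \<inter> B"] by auto
    ultimately show ?thesis by simp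
  next
    case True
    show ?thesis
    proof (cases "A = B")
      case AB: True
      have "A \<union> (Q - A) = Q" using assms by auto
      then show ?thesis
        using sum_partition_weight_same[of "Q - A" A s y] assms fin True AB by simp
    next
      case False
      have "card (A \<inter> B) \<noteq> s"
        using card_subset_eq[OF fin(1), of "A \<inter> B"] card_subset_eq[OF fin(2), of "A \<inter> B"] True False
        by auto
      then show ?thesis
        using sum_partition_weight_distinct[OF assms(1-3), of s y] True False by simp
    qed
  qed
qed

section \<open>Components of a product of diagrams\<close>

text \<open>The last claim is the universal property that lets the join replace both partitions. The
  one before it supplies the paths in the middle row of the product.\<close>

lemma join_of_partitions:
  assumes P: "partition_on V P" and P': "partition_on V P'"
  defines "\<sigma> \<equiv> V // (generated_rel (P \<union> P'))\<^sup>+"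
  shows "partition_on V \<sigma>" "refines V P \<sigma>" "refines V P' \<sigma>"
    "\<And>C x y. C \<in> \<sigma> \<Longrightarrow> x \<in> C \<Longrightarrow> y \<in> C \<Longrightarrow> (x, y) \<in> (generated_rel (P \<union> P'))\<^sup>+"
    "\<And>\<rho>. refines V \<sigma> \<rho> \<longleftrightarrow> refines V P \<rho> \<and> refines V P' \<rho>"
proof -
  let ?r = "(generated_rel (P \<union> P'))\<^sup>+"
  have "\<Union>(P \<union> P') = V"
    using partition_onD1[OF P] partition_onD1[OF P'] by auto
  note eq = partition_on_quotient_trancl[OF this]
  show \<sigma>: "partition_on V \<sigma>"
    unfolding \<sigma>_def by (rule eq)
  show conn: "(x, y) \<in> ?r" if "C \<in> \<sigma>" "x \<in> C" "y \<in> C" for C x y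
    using quotient_eq_iff[OF eq(1), of C C x y] that unfolding \<sigma>_def by simp
  have sub: "\<exists>C\<in>\<sigma>. B \<subseteq> C" if "B \<in> P \<union> P'" for B
  proof -
    have "B \<subseteq> V" "B \<noteq> {}"
      using that partition_onD1[OF P] partition_onD1[OF P'] partition_onD3[OF P] partition_onD3[OF P'] by auto
    then obtain x where x: "x \<in> B" "x \<in> V" by auto
    have "B \<subseteq> ?r `` {x}"
      using that x(1) by (auto simp: generated_rel_def)
    moreover have "?r `` {x} \<in> \<sigma>"
      unfolding \<sigma>_def using x(2) by (rule quotientI)
    ultimately show ?thesis by blast
  qed
  then show ref: "refines V P \<sigma>" "refines V P' \<sigma>"
    using P P' \<sigma> by (auto simp: refines_def)
  show "refines V \<sigma> \<rho> \<longleftrightarrow> refines V P \<rho> \<and> refines V P' \<rho>" for \<rho>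
  proof
    assume "refines V \<sigma> \<rho>"
    then show "refines V P \<rho> \<and> refines V P' \<rho>"
      using refines_trans ref by blast
  next
    assume *: "refines V P \<rho> \<and> refines V P' \<rho>"
    then have \<rho>: "partition_on V \<rho>" and fine: "\<And>B. B \<in> P \<union> P' \<Longrightarrow> \<exists>C\<in>\<rho>. B \<subseteq> C"
      by (auto simp: refines_def)
    have "\<exists>D\<in>\<rho>. C \<subseteq> D" if C: "C \<in> \<sigma>" for C
    proof -
      obtain x where x: "x \<in> C" using C partition_onD3[OF \<sigma>] by (metis all_not_in_conv)
      then have "x \<in> \<Union>\<rho>" using C partition_onD1[OF \<sigma>] partition_onD1[OF \<rho>] by blast
      then obtain D where D: "D \<in> \<rho>" "x \<in> D" by blast
      have "C \<subseteq> D"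
        using trancl_generated_rel_mem_block[OF \<rho> fine conn[OF C x] D] by blast
      then show ?thesis using D by blast
    qed
    then show "refines V \<sigma> \<rho>"
      using \<sigma> \<rho> by (simp add: refines_def)
  qed
qed

text \<open>The candidate for the component of the product over a class C of the join: all of C in
  the middle row, with the outer rows reached only along through classes, upwards by M and downwards
  by M'.\<close>

definition component_over :: "nat set set \<Rightarrow> nat set set \<Rightarrow> nat set \<Rightarrow> vertex set" where
  "component_over M M' C = {1} \<times> C \<union> {0} \<times> \<Union>{B \<in> M. B \<subseteq> C} \<union> {2} \<times> \<Union>{B \<in> M'. B \<subseteq> C}"

lemma diagram_eq:
  "diagram (\<pi>, M) = (\<lambda>B. {0, 1} \<times> B) ` M \<union> (\<lambda>B. {0} \<times> B) ` (\<pi> - M) \<union> (\<lambda>B. {1} \<times> B) ` (\<pi> - M)"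
  by (simp add: diagram_def)

lemma shift_down_diagram_eq:
  "shift_down (diagram (\<pi>, M)) =
    (\<lambda>B. {1, 2} \<times> B) ` M \<union> (\<lambda>B. {1} \<times> B) ` (\<pi> - M) \<union> (\<lambda>B. {2} \<times> B) ` (\<pi> - M)"
proof -
  have "(\<lambda>(row, i). (Suc row, i)) ` (S \<times> B) = (Suc ` S) \<times> B" for S :: "nat set" and B :: "nat set"
    by force
  then show ?thesis
    by (simp add: shift_down_def diagram_def image_Un image_image numeral_2_eq_2)
qed

text \<open>Horizontal edges in the outer rows stay isolated, and their copies in the middle row are
  absorbed by the join. The proposed family is verified by \<open>quotient_trancl_eqI\<close>: it
  partitions the vertices, each diagram block lies in one member, and members are connected.\<close>

lemma components_eq:
  assumes \<pi>: "partition_on {1..k} \<pi>" "M \<subseteq> \<pi>" and \<pi>': "partition_on {1..k} \<pi>'" "M' \<subseteq> \<pi>'"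
    and \<sigma>: "\<sigma> = {1..k} // (generated_rel (\<pi> \<union> \<pi>'))\<^sup>+"
  shows "components k (diagram (\<pi>, M)) (diagram (\<pi>', M')) =
    component_over M M' ` \<sigma> \<union> (\<lambda>B. {0} \<times> B) ` (\<pi> - M) \<union> (\<lambda>B. {2} \<times> B) ` (\<pi>' - M')"
    (is "_ = ?S")
proof -
  let ?V = "{0, 1, 2} \<times> {1..k} :: vertex set"
  let ?D = "diagram (\<pi>, M) \<union> shift_down (diagram (\<pi>', M'))"
  let ?r = "(generated_rel ?D)\<^sup>+"
  note join = join_of_partitions[OF \<pi>(1) \<pi>'(1), folded \<sigma>]
  have up: "\<exists>C\<in>\<sigma>. B \<subseteq> C" if "B \<in> \<pi> \<union> \<pi>'" for B
    using join(2,3) that unfolding refines_def by blast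
  have un\<sigma>: "\<Union>\<sigma> = {1..k}" and un\<pi>: "\<Union>\<pi> = {1..k}" and un\<pi>': "\<Union>\<pi>' = {1..k}"
    by (rule partition_onD1[symmetric], rule join(1) \<pi>(1) \<pi>'(1))+
  have same: "C = D" if "C \<in> \<sigma>" "D \<in> \<sigma>" "B \<subseteq> C" "B \<subseteq> D" "B \<in> \<pi> \<union> \<pi>'" for B C D
  proof -
    have "B \<noteq> {}" using that(5) partition_onD3[OF \<pi>(1)] partition_onD3[OF \<pi>'(1)] by blast
    then obtain x where "x \<in> B" by blast
    then show ?thesis using that partition_on_disjointD[OF join(1), of C D x] by blast
  qed
  have block0M: "{0, 1} \<times> B \<in> ?D" if "B \<in> M" for B
    unfolding shift_down_diagram_eq unfolding diagram_eq
    by (rule UnI1, rule UnI1, rule UnI1, rule image_eqI[OF refl], rule that)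
  have block0: "{0} \<times> B \<in> ?D" if "B \<in> \<pi> - M" for B
    unfolding shift_down_diagram_eq unfolding diagram_eq
    by (rule UnI1, rule UnI1, rule UnI2, rule image_eqI[OF refl], rule that)
  have block1: "{1} \<times> B \<in> ?D" if "B \<in> \<pi> - M" for B
    unfolding shift_down_diagram_eq unfolding diagram_eq
    by (rule UnI1, rule UnI2, rule image_eqI[OF refl], rule that)
  have block2M: "{1, 2} \<times> B \<in> ?D" if "B \<in> M'" for B
    unfolding shift_down_diagram_eq unfolding diagram_eq
    by (rule UnI2, rule UnI1, rule UnI1, rule image_eqI[OF refl], rule that)
  have block1': "{1} \<times> B \<in> ?D" if "B \<in> \<pi>' - M'" for B
    unfolding shift_down_diagram_eq unfolding diagram_eq
    by (rule UnI2, rule UnI1, rule UnI2, rule image_eqI[OF refl], rule that)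
  have block2: "{2} \<times> B \<in> ?D" if "B \<in> \<pi>' - M'" for B
    unfolding shift_down_diagram_eq unfolding diagram_eq
    by (rule UnI2, rule UnI2, rule image_eqI[OF refl], rule that)
  have symr: "sym ?r"
    by (rule sym_trancl) (unfold sym_def generated_rel_def, blast)
  have edge: "(p, q) \<in> ?r" if "E \<in> ?D" "p \<in> E" "q \<in> E" for E p q
  proof -
    have "(p, q) \<in> generated_rel ?D"
      unfolding generated_rel_def using that by blast
    then show ?thesis by (rule r_into_trancl)
  qed
  \<comment> \<open>Whether through class or horizontal edge, each block of either partition has its
    whole middle copy inside one block of the stacked diagrams.\<close>
  have link: "((1, x), (1, y)) \<in> ?r" if xy: "(x, y) \<in> generated_rel (\<pi> \<union> \<pi>')" for x y
  proof -
    obtain B where B: "B \<in> \<pi> \<union> \<pi>'" "x \<in> B" "y \<in> B"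
      using xy unfolding generated_rel_def by blast
    consider "B \<in> M" | "B \<in> \<pi> - M" | "B \<in> M'" | "B \<in> \<pi>' - M'" using B(1) by blast
    then have "\<exists>E\<in>?D. {1} \<times> B \<subseteq> E"
    proof cases
      case 1
      then show ?thesis by (intro bexI[OF _ block0M]) auto
    next
      case 2
      then show ?thesis by (intro bexI[OF _ block1]) auto
    next
      case 3
      then show ?thesis by (intro bexI[OF _ block2M]) auto
    next
      case 4
      then show ?thesis by (intro bexI[OF _ block1']) auto
    qed
    then obtain E where "E \<in> ?D" "(1, x) \<in> E" "(1, y) \<in> E" using B by blast
    then show ?thesis by (rule edge)
  qed
  have mid: "((1, x), (1, y)) \<in> ?r" if "(x, y) \<in> (generated_rel (\<pi> \<union> \<pi>'))\<^sup>+" for x y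
    using that
  proof (induction rule: trancl_induct)
    case (base y)
    then show ?case by (rule link)
  next
    case (step y z)
    show ?case using step(3) link[OF step(2)]
      by (rule trancl_trans)
  qed
  \<comment> \<open>Every vertex over C is tied to a middle vertex in C, so two such vertices are
    connected by way of the middle row.\<close>
  have anchor: "\<exists>i\<in>C. (p, (1, i)) \<in> ?r" if C: "C \<in> \<sigma>" and p: "p \<in> component_over M M' C" for C p
  proof -
    consider i where "p = (1, i)" "i \<in> C"
      | i B where "p = (0, i)" "B \<in> M" "B \<subseteq> C" "i \<in> B"
      | i B where "p = (2, i)" "B \<in> M'" "B \<subseteq> C" "i \<in> B"
      using p unfolding component_over_def by blast
    then show ?thesis
    proof cases
      case (1 i)
      then show ?thesis using mid join(4)[OF C] by blast
    next
      case (2 i B)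
      then have "(p, (1, i)) \<in> ?r"
        by (intro edge[OF block0M]) auto
      then show ?thesis using 2 by blast
    next
      case (3 i B)
      then have "(p, (1, i)) \<in> ?r"
        by (intro edge[OF block2M]) auto
      then show ?thesis using 3 by blast
    qed
  qed
  have over_mem: "component_over M M' C \<in> ?S" if "C \<in> \<sigma>" for C
    using that by (intro UnI1 imageI)
  have part: "partition_on ?V ?S"
  proof (rule partition_onI)
    have "M \<union> (\<pi> - M) = \<pi>" "M' \<union> (\<pi>' - M') = \<pi>'" using \<pi>(2) \<pi>'(2) by auto
    then have M: "\<Union>M \<union> \<Union>(\<pi> - M) = {1..k}" "\<Union>M' \<union> \<Union>(\<pi>' - M') = {1..k}"
      using un\<pi> un\<pi>' unfolding Union_Un_distrib[symmetric] by simp_all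
    have up_union: "(\<Union>C\<in>\<sigma>. \<Union>{B \<in> N. B \<subseteq> C}) = \<Union>N" if N: "N \<subseteq> \<pi> \<union> \<pi>'" for N
    proof (intro equalityI subsetI)
      fix x assume "x \<in> \<Union>N"
      then obtain B where B: "B \<in> N" "x \<in> B" by blast
      then obtain C where "C \<in> \<sigma>" "B \<subseteq> C" using up[of B] N by blast
      then show "x \<in> (\<Union>C\<in>\<sigma>. \<Union>{B \<in> N. B \<subseteq> C})" using B by blast
    qed auto
    then have upM: "(\<Union>C\<in>\<sigma>. \<Union>{B \<in> M. B \<subseteq> C}) = \<Union>M" "(\<Union>C\<in>\<sigma>. \<Union>{B \<in> M'. B \<subseteq> C}) = \<Union>M'"
      using \<pi>(2) \<pi>'(2) by (simp_all add: le_supI1 le_supI2)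
    have over: "\<Union>(component_over M M' ` \<sigma>) = {1} \<times> \<Union>\<sigma> \<union> {0} \<times> (\<Union>C\<in>\<sigma>. \<Union>{B \<in> M. B \<subseteq> C}) \<union>
        {2} \<times> (\<Union>C\<in>\<sigma>. \<Union>{B \<in> M'. B \<subseteq> C})"
      unfolding component_over_def by auto
    have row: "\<Union>((\<lambda>B. {a} \<times> B) ` N) = {a} \<times> \<Union>N" for a :: nat and N :: "nat set set"
      by auto
    have glue: "{1} \<times> W \<union> {0} \<times> S \<union> {2} \<times> T \<union> {0} \<times> S' \<union> {2} \<times> T' = {0, 1, 2} \<times> W"
      if "S \<union> S' = W" "T \<union> T' = W" for W S S' T T' :: "nat set"
      unfolding that(1)[symmetric] using that(2) unfolding that(1)[symmetric] by blast
    show Un: "\<Union>?S = ?V"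
      unfolding Union_Un_distrib over row upM un\<sigma> by (rule glue[OF M])
    show "{} \<notin> ?S"
      using partition_onD3[OF join(1)] partition_onD3[OF \<pi>(1)] partition_onD3[OF \<pi>'(1)]
      by (auto simp: component_over_def eq_commute[of "{}"])
    \<comment> \<open>Row by row, a vertex determines the member of the family that contains it;
      this yields disjointness.\<close>
    have row1: "\<exists>C\<in>\<sigma>. i \<in> C \<and> p = component_over M M' C" if p: "p \<in> ?S" and pi: "(1, i) \<in> p" for p i
    proof -
      consider C where "C \<in> \<sigma>" "p = component_over M M' C" | B where "p = {0} \<times> B" | B where "p = {2} \<times> B"
        using p by blast
      then show ?thesis
      proof cases
        case (1 C)
        then show ?thesis using pi by (intro bexI[of _ C]) (auto simp: component_over_def)
      qed (use pi in auto)
    qed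
    have row0: "\<exists>B\<in>\<pi>. i \<in> B \<and> (B \<in> M \<and> (\<exists>C\<in>\<sigma>. B \<subseteq> C \<and> p = component_over M M' C) \<or> B \<notin> M \<and> p = {0} \<times> B)"
      if p: "p \<in> ?S" and pi: "(0, i) \<in> p" for p i
    proof -
      consider C where "C \<in> \<sigma>" "p = component_over M M' C" | B where "B \<in> \<pi> - M" "p = {0} \<times> B"
        | B where "p = {2} \<times> B"
        using p by blast
      then show ?thesis
      proof cases
        case (1 C)
        then obtain B where "B \<in> M" "B \<subseteq> C" "i \<in> B" using pi by (auto simp: component_over_def)
        then show ?thesis using 1 \<pi>(2) by blast
      qed (use pi in auto)
    qed
    have row2: "\<exists>B\<in>\<pi>'. i \<in> B \<and> (B \<in> M' \<and> (\<exists>C\<in>\<sigma>. B \<subseteq> C \<and> p = component_over M M' C) \<or> B \<notin> M' \<and> p = {2} \<times> B)"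
      if p: "p \<in> ?S" and pi: "(2, i) \<in> p" for p i
    proof -
      consider C where "C \<in> \<sigma>" "p = component_over M M' C" | B where "p = {0} \<times> B"
        | B where "B \<in> \<pi>' - M'" "p = {2} \<times> B"
        using p by blast
      then show ?thesis
      proof cases
        case (1 C)
        then obtain B where "B \<in> M'" "B \<subseteq> C" "i \<in> B" using pi by (auto simp: component_over_def)
        then show ?thesis using 1 \<pi>'(2) by blast
      qed (use pi in auto)
    qed
    have disj: "p = q" if pq: "p \<in> ?S" "q \<in> ?S" "v \<in> p" "v \<in> q" for p q v
    proof -
      obtain a i where v: "v = (a, i)" by fastforce
      have "v \<in> ?V" unfolding Un[symmetric] using pq(1,3) by (rule UnionI)
      then consider "a = 0" | "a = 1" | "a = 2" using v by auto
      then show ?thesis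
      proof cases
        case 1
        obtain B where B: "B \<in> \<pi>" "i \<in> B" "B \<in> M \<and> (\<exists>C\<in>\<sigma>. B \<subseteq> C \<and> p = component_over M M' C) \<or> B \<notin> M \<and> p = {0} \<times> B"
          using row0[OF pq(1), of i] pq(3) v 1 by blast
        obtain B' where B': "B' \<in> \<pi>" "i \<in> B'" "B' \<in> M \<and> (\<exists>C\<in>\<sigma>. B' \<subseteq> C \<and> q = component_over M M' C) \<or> B' \<notin> M \<and> q = {0} \<times> B'"
          using row0[OF pq(2), of i] pq(4) v 1 by blast
        have BB: "B' = B" using partition_on_disjointD[OF \<pi>(1) B'(1) B(1) B'(2) B(2)] .
        show ?thesis
        proof (cases "B \<in> M")
          case True
          obtain C where C: "C \<in> \<sigma>" "B \<subseteq> C" "p = component_over M M' C" using B(3) True by blast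
          obtain D where D: "D \<in> \<sigma>" "B \<subseteq> D" "q = component_over M M' D" using B'(3) True unfolding BB by blast
          have "C = D" using same[OF C(1) D(1) C(2) D(2)] B(1) by blast
          then show ?thesis using C D by simp
        next
          case False
          then show ?thesis using B(3) B'(3) unfolding BB by blast
        qed
      next
        case 2
        obtain C where C: "C \<in> \<sigma>" "i \<in> C" "p = component_over M M' C"
          using row1[OF pq(1), of i] pq(3) v 2 by blast
        obtain D where D: "D \<in> \<sigma>" "i \<in> D" "q = component_over M M' D"
          using row1[OF pq(2), of i] pq(4) v 2 by blast
        have "C = D" using partition_on_disjointD[OF join(1) C(1) D(1) C(2) D(2)] .
        then show ?thesis using C D by simp
      next
        case 3
        obtain B where B: "B \<in> \<pi>'" "i \<in> B" "B \<in> M' \<and> (\<exists>C\<in>\<sigma>. B \<subseteq> C \<and> p = component_over M M' C) \<or> B \<notin> M' \<and> p = {2} \<times> B"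
          using row2[OF pq(1), of i] pq(3) v 3 by blast
        obtain B' where B': "B' \<in> \<pi>'" "i \<in> B'" "B' \<in> M' \<and> (\<exists>C\<in>\<sigma>. B' \<subseteq> C \<and> q = component_over M M' C) \<or> B' \<notin> M' \<and> q = {2} \<times> B'"
          using row2[OF pq(2), of i] pq(4) v 3 by blast
        have BB: "B' = B" using partition_on_disjointD[OF \<pi>'(1) B'(1) B(1) B'(2) B(2)] .
        show ?thesis
        proof (cases "B \<in> M'")
          case True
          obtain C where C: "C \<in> \<sigma>" "B \<subseteq> C" "p = component_over M M' C" using B(3) True by blast
          obtain D where D: "D \<in> \<sigma>" "B \<subseteq> D" "q = component_over M M' D" using B'(3) True unfolding BB by blast
          have "C = D" using same[OF C(1) D(1) C(2) D(2)] B(1) by blast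
          then show ?thesis using C D by simp
        next
          case False
          then show ?thesis using B(3) B'(3) unfolding BB by blast
        qed
      qed
    qed
    fix p q assume "p \<in> ?S" "q \<in> ?S" "p \<noteq> q"
    then show "disjnt p q" unfolding disjnt_iff using disj by metis
  qed
  have "?V // ?r = ?S"
  proof (rule quotient_trancl_eqI[OF part])
    fix E assume "E \<in> ?D"
    then consider B where "B \<in> M" "E = {0, 1} \<times> B" | B where "B \<in> M'" "E = {1, 2} \<times> B"
      | B where "B \<in> \<pi> \<union> \<pi>'" "E = {1} \<times> B" | B where "B \<in> \<pi> - M" "E = {0} \<times> B"
      | B where "B \<in> \<pi>' - M'" "E = {2} \<times> B"
      unfolding shift_down_diagram_eq unfolding diagram_eq
    proof (elim UnE imageE)
      fix B assume "B \<in> M" "E = {0, 1} \<times> B"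
      then show thesis by (rule that(1))
    next
      fix B assume "B \<in> \<pi> - M" "E = {0} \<times> B"
      then show thesis by (rule that(4))
    next
      fix B assume "B \<in> \<pi> - M" "E = {1} \<times> B"
      then show thesis by (intro that(3)[of B]) auto
    next
      fix B assume "B \<in> M'" "E = {1, 2} \<times> B"
      then show thesis by (rule that(2))
    next
      fix B assume "B \<in> \<pi>' - M'" "E = {1} \<times> B"
      then show thesis by (intro that(3)[of B]) auto
    next
      fix B assume "B \<in> \<pi>' - M'" "E = {2} \<times> B"
      then show thesis by (rule that(5))
    qed
    then show "\<exists>C\<in>?S. E \<subseteq> C"
    proof cases
      case (1 B)
      then obtain C where "C \<in> \<sigma>" "B \<subseteq> C" using up[of B] \<pi>(2) by blast
      then show ?thesis using 1 by (intro bexI[OF _ over_mem[of C]]) (auto simp: component_over_def)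
    next
      case (2 B)
      then obtain C where "C \<in> \<sigma>" "B \<subseteq> C" using up[of B] \<pi>'(2) by blast
      then show ?thesis using 2 by (intro bexI[OF _ over_mem[of C]]) (auto simp: component_over_def)
    next
      case (3 B)
      then obtain C where "C \<in> \<sigma>" "B \<subseteq> C" using up[of B] by blast
      then show ?thesis using 3 by (intro bexI[OF _ over_mem[of C]]) (auto simp: component_over_def)
    qed auto
  next
    fix E p q assume E: "E \<in> ?S" "p \<in> E" "q \<in> E"
    from E(1) consider C where "C \<in> \<sigma>" "E = component_over M M' C"
      | B where "B \<in> \<pi> - M" "E = {0} \<times> B" | B where "B \<in> \<pi>' - M'" "E = {2} \<times> B"
    proof (elim UnE imageE)
      fix C assume "E = component_over M M' C" "C \<in> \<sigma>"
      then show thesis by (intro that(1))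
    next
      fix B assume "E = {0} \<times> B" "B \<in> \<pi> - M"
      then show thesis by (intro that(2))
    next
      fix B assume "E = {2} \<times> B" "B \<in> \<pi>' - M'"
      then show thesis by (intro that(3))
    qed
    then show "(p, q) \<in> ?r"
    proof cases
      case (1 C)
      have "p \<in> component_over M M' C" "q \<in> component_over M M' C" using E(2,3) 1(2) by simp_all
      then obtain i j where ij: "i \<in> C" "(p, (1, i)) \<in> ?r" "j \<in> C" "(q, (1, j)) \<in> ?r"
        using anchor[OF 1(1)] by metis
      have "((1, i), (1, j)) \<in> ?r"
        using mid join(4)[OF 1(1) ij(1,3)] by blast
      with ij(2) have "(p, (1, j)) \<in> ?r" by (rule trancl_trans)
      moreover have "((1, j), q) \<in> ?r" using symr ij(4) by (rule symD)
      ultimately show ?thesis by (rule trancl_trans)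
    next
      case (2 B)
      then show ?thesis using edge[OF block0] E by blast
    next
      case (3 B)
      then show ?thesis using edge[OF block2] E by blast
    qed
  qed
  then show ?thesis
    by (simp only: components_def generated_rel_def)
qed

text \<open>The component over C reaches the top row iff C contains a class of M, and the bottom row
  iff it contains one of M'. Isolated outer edges are neither propagating nor in the middle
  row.\<close>

lemma gram_entry_join:
  assumes \<pi>: "partition_on {1..k} \<pi>" "M \<subseteq> \<pi>" and \<pi>': "partition_on {1..k} \<pi>'" "M' \<subseteq> \<pi>'"
    and \<sigma>: "\<sigma> = {1..k} // (generated_rel (\<pi> \<union> \<pi>'))\<^sup>+"
  shows "gram_entry k s (\<pi>, M) (\<pi>', M') =
    (if card (lift_classes M \<sigma> \<inter> lift_classes M' \<sigma>) = s
     then X_var ^ card (\<sigma> - (lift_classes M \<sigma> \<union> lift_classes M' \<sigma>)) else 0)"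
proof -
  let ?K = "component_over M M'"
  note join = join_of_partitions[OF \<pi>(1) \<pi>'(1), folded \<sigma>]
  have ne: "B \<noteq> {}" if "B \<in> \<pi> \<union> \<pi>' \<union> \<sigma>" for B
    using that partition_onD3[OF \<pi>(1)] partition_onD3[OF \<pi>'(1)] partition_onD3[OF join(1)] by auto
  \<comment> \<open>C is recovered as the middle row of the component over it.\<close>
  have inj: "inj_on ?K N" for N
    by (rule inj_on_inverseI[where g = "\<lambda>E. {i. (1, i) \<in> E}"]) (auto simp: component_over_def)
  have top: "(\<exists>i. (0, i) \<in> ?K C) \<longleftrightarrow> (\<exists>B\<in>M. B \<subseteq> C)" for C
    using ne \<pi>(2) by (fastforce simp: component_over_def)
  have bot: "(\<exists>i. (2, i) \<in> ?K C) \<longleftrightarrow> (\<exists>B\<in>M'. B \<subseteq> C)" for C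
    using ne \<pi>'(2) by (fastforce simp: component_over_def)
  have "{E \<in> components k (diagram (\<pi>, M)) (diagram (\<pi>', M')). (\<exists>i. (0, i) \<in> E) \<and> (\<exists>i. (2, i) \<in> E)} =
      ?K ` {C \<in> \<sigma>. (\<exists>i. (0, i) \<in> ?K C) \<and> (\<exists>i. (2, i) \<in> ?K C)}"
    unfolding components_eq[OF assms] by auto
  also have "{C \<in> \<sigma>. (\<exists>i. (0, i) \<in> ?K C) \<and> (\<exists>i. (2, i) \<in> ?K C)} = lift_classes M \<sigma> \<inter> lift_classes M' \<sigma>"
    unfolding top bot lift_classes_def by blast
  finally have 1: "propagating_number k (diagram (\<pi>, M)) (diagram (\<pi>', M')) =
      card (lift_classes M \<sigma> \<inter> lift_classes M' \<sigma>)"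
    by (simp add: propagating_number_def card_image[OF inj])
  have mid: "?K C \<subseteq> {1} \<times> {1..k} \<longleftrightarrow> \<not> (\<exists>B\<in>M. B \<subseteq> C) \<and> \<not> (\<exists>B\<in>M'. B \<subseteq> C)" if "C \<in> \<sigma>" for C
  proof -
    have "C \<subseteq> {1..k}" using that partition_onD1[OF join(1)] by auto
    have "?K C \<subseteq> {1} \<times> {1..k} \<longleftrightarrow> \<not> (\<exists>i. (0, i) \<in> ?K C) \<and> \<not> (\<exists>i. (2, i) \<in> ?K C)"
    proof
      assume sub: "?K C \<subseteq> {1} \<times> {1..k}"
      have "(a, i) \<notin> ?K C" if "a \<noteq> 1" for a i
        using subsetD[OF sub, of "(a, i)"] that by auto
      then show "\<not> (\<exists>i. (0, i) \<in> ?K C) \<and> \<not> (\<exists>i. (2, i) \<in> ?K C)"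
        by simp
    next
      assume none: "\<not> (\<exists>i. (0, i) \<in> ?K C) \<and> \<not> (\<exists>i. (2, i) \<in> ?K C)"
      show "?K C \<subseteq> {1} \<times> {1..k}"
      proof
        fix v assume v: "v \<in> ?K C"
        obtain a i where ai: "v = (a, i)" by fastforce
        have "a = 0 \<or> a = 2 \<or> a = 1 \<and> i \<in> C"
          using v unfolding ai component_over_def by blast
        then show "v \<in> {1} \<times> {1..k}"
          using v none \<open>C \<subseteq> {1..k}\<close> unfolding ai by blast
      qed
    qed
    then show ?thesis unfolding top bot .
  qed
  have side: "\<not> {a} \<times> B \<subseteq> {1} \<times> {1..k}" if "B \<in> \<pi> \<union> \<pi>'" "a \<noteq> 1" for a :: nat and B
    using ne[of B] that by auto
  have "{E \<in> components k (diagram (\<pi>, M)) (diagram (\<pi>', M')). E \<subseteq> {1} \<times> {1..k}} =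
      ?K ` (\<sigma> - (lift_classes M \<sigma> \<union> lift_classes M' \<sigma>))"
    (is "?L = ?R")
  proof -
    have "?L = ?K ` {C \<in> \<sigma>. ?K C \<subseteq> {1} \<times> {1..k}}"
      unfolding components_eq[OF assms] using side[of _ 0] side[of _ 2] by auto
    also have "{C \<in> \<sigma>. ?K C \<subseteq> {1} \<times> {1..k}} = \<sigma> - (lift_classes M \<sigma> \<union> lift_classes M' \<sigma>)"
      using mid by (auto simp: lift_classes_def)
    finally show ?thesis .
  qed
  then have 2: "middle_components k (diagram (\<pi>, M)) (diagram (\<pi>', M')) =
      card (\<sigma> - (lift_classes M \<sigma> \<union> lift_classes M' \<sigma>))"
    by (simp add: middle_components_def card_image[OF inj])
  show ?thesis
    by (simp add: gram_entry_def 1 2)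
qed

section \<open>The congruence between the two Gram matrices\<close>

text \<open>The indices come in arbitrary order, so the argument goes through f: a permutation other
  than the identity with nonzero product would strictly increase the sum of f over all indices,
  which permuting leaves unchanged.\<close>

lemma det_unitriangular:
  fixes A :: "'a::comm_ring_1 mat" and f :: "nat \<Rightarrow> nat"
  assumes A: "A \<in> carrier_mat n n" and diag: "\<And>i. i < n \<Longrightarrow> A $$ (i, i) = 1"
    and tri: "\<And>i j. i < n \<Longrightarrow> j < n \<Longrightarrow> i \<noteq> j \<Longrightarrow> A $$ (i, j) \<noteq> 0 \<Longrightarrow> f i < f j"
  shows "det A = 1"
proof -
  have zero: "(\<Prod>i = 0..<n. A $$ (i, p i)) = 0" if p: "p permutes {0..<n}" "p \<noteq> id" for p
  proof (rule ccontr)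
    assume prod: "(\<Prod>i = 0..<n. A $$ (i, p i)) \<noteq> 0"
    have nz: "A $$ (i, p i) \<noteq> 0" if "i < n" for i
    proof
      assume "A $$ (i, p i) = 0"
      then have "(\<Prod>i = 0..<n. A $$ (i, p i)) = 0"
        using that by (intro prod_zero bexI[of _ i]) auto
      then show False using prod by simp
    qed
    have pn: "p i < n" if "i < n" for i
      using permutes_in_image[OF p(1), of i] that by simp
    obtain i where i: "p i \<noteq> i" using p(2) by (auto simp: fun_eq_iff)
    then have "i < n" using p(1) permutes_not_in[of p "{0..<n}" i] by force
    then have "(\<Sum>i\<in>{0..<n}. f i) < (\<Sum>i\<in>{0..<n}. f (p i))"
    proof (intro sum_strict_mono_ex1 ballI bexI)
      fix j assume "j \<in> {0..<n}"
      then show "f j \<le> f (p j)"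
        using tri[of j "p j"] nz[of j] pn[of j] by (cases "p j = j") auto
    next
      show "f i < f (p i)"
        using tri[of i "p i"] nz[of i] pn[of i] i \<open>i < n\<close> by auto
    qed auto
    moreover have "(\<Sum>i\<in>{0..<n}. f (p i)) = (\<Sum>i\<in>{0..<n}. f i)"
      using sum.permute[OF p(1), of f] by (simp add: o_def)
    ultimately show False by simp
  qed
  have "det A = (\<Sum>p\<in>{p. p permutes {0..<n}}. signof p * (\<Prod>i = 0..<n. A $$ (i, p i)))"
    by (rule det_def'[OF A])
  also have "\<dots> = (\<Sum>p\<in>{id}. signof p * (\<Prod>i = 0..<n. A $$ (i, p i)))"
    using zero by (intro sum.mono_neutral_right) (auto simp: permutes_id finite_permutations)
  also have "\<dots> = 1"
    using diag by simp
  finally show ?thesis .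
qed

lemma partition_on_card_le:
  assumes "finite V" "partition_on V P"
  shows "card P \<le> card V"
  using card_meeting_le[OF assms(2,1)] meeting_self_eq[OF assms(2)] by simp

section \<open>The index set and the coarsening relation between diagrams\<close>

lemma JJ_iff:
  "(\<pi>, M) \<in> JJ k s r \<longleftrightarrow> partition_on {1..k} \<pi> \<and> card \<pi> = s + r \<and> M \<subseteq> \<pi> \<and> card M = s"
  by (simp add: JJ_def)

text \<open>The number r is recovered as \<open>card \<pi> - s\<close>. It is in range because M
  \<subseteq> \<pi> gives s \<le> \<open>card \<pi>\<close>, and k points form at most k
  blocks.\<close>

lemma J_iff:
  assumes "s \<le> k"
  shows "(\<pi>, M) \<in> J k s \<longleftrightarrow> partition_on {1..k} \<pi> \<and> M \<subseteq> \<pi> \<and> card M = s"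
proof
  assume "(\<pi>, M) \<in> J k s"
  then show "partition_on {1..k} \<pi> \<and> M \<subseteq> \<pi> \<and> card M = s"
    by (auto simp: J_def JJ_iff)
next
  assume *: "partition_on {1..k} \<pi> \<and> M \<subseteq> \<pi> \<and> card M = s"
  then have "card \<pi> \<le> k" using partition_on_card_le[of "{1..k}" \<pi>] by simp
  moreover have "finite \<pi>" using * finite_elements[of "{1..k}" \<pi>] by simp
  then have "s \<le> card \<pi>" using * card_mono[of \<pi> M] by simp
  ultimately have "(\<pi>, M) \<in> JJ k s (card \<pi> - s)" "card \<pi> - s \<in> {0..k - s}"
    using * by (auto simp: JJ_iff)
  then show "(\<pi>, M) \<in> J k s" unfolding J_def by blast
qed

lemma finite_J: "s \<le> k \<Longrightarrow> finite (J k s)"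
proof -
  assume s: "s \<le> k"
  have "J k s \<subseteq> Pow (Pow {1..k}) \<times> Pow (Pow {1..k})"
  proof
    fix d assume "d \<in> J k s"
    moreover obtain \<pi> M where d: "d = (\<pi>, M)" by fastforce
    ultimately have *: "partition_on {1..k} \<pi>" "M \<subseteq> \<pi>" by (auto simp: J_iff[OF s])
    then have "\<pi> \<subseteq> Pow {1..k}" using partition_onD1[OF *(1)] by blast
    then show "d \<in> Pow (Pow {1..k}) \<times> Pow (Pow {1..k})" using * d by auto
  qed
  then show ?thesis by (rule finite_subset) simp
qed

text \<open>The second diagram is the coarser one. That s through classes survive is not part of the
  relation; it is enforced by letting the coarser diagram range over \<open>J k s\<close>.\<close>

definition coarsens :: "nat \<Rightarrow> sdiagram \<Rightarrow> sdiagram \<Rightarrow> bool" where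
  "coarsens k d e \<longleftrightarrow> refines {1..k} (fst d) (fst e) \<and> snd e = lift_classes (snd d) (fst e)"

lemma coarsens_refl:
  assumes "s \<le> k" "d \<in> J k s"
  shows "coarsens k d d"
proof -
  obtain \<pi> M where d: "d = (\<pi>, M)" by fastforce
  then have *: "partition_on {1..k} \<pi>" "M \<subseteq> \<pi>" using assms(2) by (auto simp: J_iff[OF assms(1)])
  show ?thesis
    using refines_refl[OF *(1)] lift_classes_self[OF *] by (simp add: coarsens_def d)
qed

text \<open>Choosing a finer block inside each coarser one is injective. Equal cardinalities would
  make it onto and the two partitions equal, and the lifted through classes would then be the
  original ones.\<close>

lemma coarsens_card_less:
  assumes s: "s \<le> k" and de: "d \<in> J k s" "e \<in> J k s" and coa: "coarsens k d e" and ne: "e \<noteq> d"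
  shows "card (fst e) < card (fst d)"
proof -
  obtain \<pi> M where d: "d = (\<pi>, M)" by fastforce
  obtain \<rho> N where e: "e = (\<rho>, N)" by fastforce
  have \<pi>: "partition_on {1..k} \<pi>" "M \<subseteq> \<pi>" using de(1) d by (auto simp: J_iff[OF s])
  have ref: "refines {1..k} \<pi> \<rho>" and N: "N = lift_classes M \<rho>"
    using coa by (auto simp: coarsens_def d e)
  then have \<rho>: "partition_on {1..k} \<rho>" by (simp add: refines_def)
  have "finite \<pi>" using \<pi>(1) finite_elements by blast
  have "\<forall>D\<in>\<rho>. \<exists>B. B \<in> \<pi> \<and> B \<subseteq> D"
  proof
    fix D assume D: "D \<in> \<rho>"
    have "D \<noteq> {}" using D partition_onD3[OF \<rho>] by auto
    then have "{p \<in> \<pi>. p \<subseteq> D} \<noteq> {}"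
      using partition_onD1[OF refines_obtains_subset[OF ref D]] by auto
    then show "\<exists>B. B \<in> \<pi> \<and> B \<subseteq> D" by blast
  qed
  then obtain g where g: "\<And>D. D \<in> \<rho> \<Longrightarrow> g D \<in> \<pi> \<and> g D \<subseteq> D" by metis
  have inj: "inj_on g \<rho>"
  proof (rule inj_onI)
    fix D E assume DE: "D \<in> \<rho>" "E \<in> \<rho>" "g D = g E"
    then have "g D \<noteq> {}" using g[of D] partition_onD3[OF \<pi>(1)] by auto
    then obtain x where "x \<in> g D" by blast
    then have "x \<in> D" "x \<in> E" using g[of D] g[of E] DE by auto
    then show "D = E" by (rule partition_on_disjointD[OF \<rho> DE(1,2)])
  qed
  have sub: "g ` \<rho> \<subseteq> \<pi>" using g by blast
  have le: "card \<rho> \<le> card \<pi>"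
    using inj sub \<open>finite \<pi>\<close> by (rule card_inj_on_le)
  have "card \<rho> \<noteq> card \<pi>"
  proof
    assume eq: "card \<rho> = card \<pi>"
    then have onto: "g ` \<rho> = \<pi>"
      using card_subset_eq[OF \<open>finite \<pi>\<close> sub] card_image[OF inj] by simp
    have "refines {1..k} \<rho> \<pi>"
      unfolding refines_def
    proof (intro conjI ballI \<rho> \<pi>(1))
      fix D assume D: "D \<in> \<rho>"
      have "D \<subseteq> g D"
      proof
        fix x assume x: "x \<in> D"
        then have "x \<in> \<Union>\<pi>" using D partition_onD1[OF \<rho>] partition_onD1[OF \<pi>(1)] by blast
        then obtain E where E: "E \<in> \<rho>" "x \<in> g E" using onto by blast
        then have "x \<in> E" using g by blast
        then have "D = E" using partition_on_disjointD[OF \<rho> D E(1) x] by blast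
        then show "x \<in> g D" using E by simp
      qed
      then show "\<exists>Y\<in>\<pi>. D \<subseteq> Y" using g[OF D] by blast
    qed
    then have "\<rho> = \<pi>" using refines_asym[OF ref] by simp
    then have "e = d" using N lift_classes_self[OF \<pi>] d e by simp
    then show False using ne by simp
  qed
  with le show ?thesis by (simp add: d e)
qed

text \<open>A coarser diagram is determined by its partition, so only a sum over partitions remains;
  membership in \<open>J k s\<close> turns into the condition that s classes survive.\<close>

lemma sum_coarsens:
  fixes h :: "sdiagram \<Rightarrow> 'b::comm_ring_1"
  assumes s: "s \<le> k"
  shows "(\<Sum>e\<in>J k s. of_bool (coarsens k (\<pi>, M) e) * h e) =
    (\<Sum>\<rho> | refines {1..k} \<pi> \<rho>. if card (lift_classes M \<rho>) = s then h (\<rho>, lift_classes M \<rho>) else 0)"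
proof -
  have fin: "finite {\<rho>. refines {1..k} \<pi> \<rho>}"
    by (rule finite_subset[OF _ finitely_many_partition_on[of "{1..k}"]]) (auto simp: refines_def)
  have "(\<Sum>e\<in>J k s. of_bool (coarsens k (\<pi>, M) e) * h e) = (\<Sum>e\<in>{e \<in> J k s. coarsens k (\<pi>, M) e}. h e)"
    using finite_J[OF s] by (intro sum.mono_neutral_cong_right) auto
  also have "\<dots> = (\<Sum>\<rho> | refines {1..k} \<pi> \<rho> \<and> card (lift_classes M \<rho>) = s. h (\<rho>, lift_classes M \<rho>))"
  proof (rule sum.reindex_bij_witness[where i = "\<lambda>\<rho>. (\<rho>, lift_classes M \<rho>)" and j = fst])
    fix e assume e: "e \<in> {e \<in> J k s. coarsens k (\<pi>, M) e}"
    obtain \<rho> N where "e = (\<rho>, N)" by fastforce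
    with e show "(fst e, lift_classes M (fst e)) = e"
      "fst e \<in> {\<rho>. refines {1..k} \<pi> \<rho> \<and> card (lift_classes M \<rho>) = s}"
      "h (fst e, lift_classes M (fst e)) = h e"
      by (auto simp: coarsens_def J_iff[OF s])
  next
    fix \<rho> assume "\<rho> \<in> {\<rho>. refines {1..k} \<pi> \<rho> \<and> card (lift_classes M \<rho>) = s}"
    then show "(\<rho>, lift_classes M \<rho>) \<in> {e \<in> J k s. coarsens k (\<pi>, M) e}"
      by (auto simp: coarsens_def J_iff[OF s] refines_def lift_classes_def)
  qed simp
  also have "\<dots> = (\<Sum>\<rho> | refines {1..k} \<pi> \<rho>. if card (lift_classes M \<rho>) = s then h (\<rho>, lift_classes M \<rho>) else 0)"
    using fin by (intro sum.mono_neutral_cong_left) auto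
  finally show ?thesis .
qed

text \<open>The distance of two s-subsets is at most min s r, so the double subtraction from min s r
  inside \<open>gram_X\<close> returns it exactly.\<close>

lemma gram_entry'_same:
  assumes "finite \<pi>" "M \<subseteq> \<pi>" "M' \<subseteq> \<pi>" "card M = s" "card M' = s"
  shows "gram_entry' s (\<pi>, M) (\<pi>, M') = gram_weight (X_var - of_nat s) (card \<pi> - s) (card (M - M'))"
proof -
  have fin: "finite M" "finite M'" using assms finite_subset by auto
  have "card (M - M') \<le> s" using fin assms card_mono[of M "M - M'"] by auto
  moreover have "card (M - M') \<le> card (\<pi> - M')" using assms by (intro card_mono) auto
  then have "card (M - M') \<le> card \<pi> - s" using assms fin by (simp add: card_Diff_subset)
  ultimately show ?thesis
    using gram_X_eq_gram_weight[of "card (M - M')" s "card \<pi> - s"]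
    by (simp add: gram_entry'_def)
qed

text \<open>The double sum is the entry of Z^T G' Z at (d, e).\<close>

lemma gram_entry_congruence:
  assumes s: "s \<le> k" and d: "d \<in> J k s" and e: "e \<in> J k s"
  shows "(\<Sum>i\<in>J k s. \<Sum>j\<in>J k s.
      of_bool (coarsens k d i) * gram_entry' s i j * of_bool (coarsens k e j)) = gram_entry k s d e"
proof -
  obtain \<pi> M where dM: "d = (\<pi>, M)" by fastforce
  obtain \<pi>' M' where eM: "e = (\<pi>', M')" by fastforce
  have \<pi>: "partition_on {1..k} \<pi>" "M \<subseteq> \<pi>" "card M = s" using d dM by (auto simp: J_iff[OF s])
  have \<pi>': "partition_on {1..k} \<pi>'" "M' \<subseteq> \<pi>'" "card M' = s" using e eM by (auto simp: J_iff[OF s])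
  define \<sigma> where "\<sigma> = {1..k} // (generated_rel (\<pi> \<union> \<pi>'))\<^sup>+"
  note join = join_of_partitions[OF \<pi>(1) \<pi>'(1), folded \<sigma>_def]
  let ?y = "X_var - of_nat s"
  let ?ref = "\<lambda>\<pi> \<rho>. refines {1..k} \<pi> \<rho>"
  have fin_ref: "finite {\<rho>. ?ref \<pi> \<rho>}" for \<pi>
    by (rule finite_subset[OF _ finitely_many_partition_on[of "{1..k}"]]) (auto simp: refines_def)
  \<comment> \<open>G' vanishes between different partitions, so of the two coarsenings only a
    common one contributes.\<close>
  have inner: "(\<Sum>\<rho>' | ?ref \<pi>' \<rho>'. if card (lift_classes M' \<rho>') = s
        then gram_entry' s (\<rho>, lift_classes M \<rho>) (\<rho>', lift_classes M' \<rho>') else 0) =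
      (if ?ref \<pi>' \<rho> then coarsening_weight ?y s M M' \<rho> else 0)"
    if \<rho>: "?ref \<pi> \<rho>" "card (lift_classes M \<rho>) = s" for \<rho>
  proof -
    have "partition_on {1..k} \<rho>" using \<rho>(1) by (simp add: refines_def)
    then have finr: "finite \<rho>" using finite_elements by blast
    have "(\<Sum>\<rho>' | ?ref \<pi>' \<rho>'. if card (lift_classes M' \<rho>') = s
        then gram_entry' s (\<rho>, lift_classes M \<rho>) (\<rho>', lift_classes M' \<rho>') else 0) =
      (\<Sum>\<rho>' | ?ref \<pi>' \<rho>'. if \<rho> = \<rho>' then coarsening_weight ?y s M M' \<rho> else 0)"
    proof (intro sum.cong refl)
      fix \<rho>'
      show "(if card (lift_classes M' \<rho>') = s
          then gram_entry' s (\<rho>, lift_classes M \<rho>) (\<rho>', lift_classes M' \<rho>') else 0) =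
        (if \<rho> = \<rho>' then coarsening_weight ?y s M M' \<rho> else 0)"
      proof (cases "\<rho> = \<rho>'")
        case True
        have "lift_classes M \<rho> \<subseteq> \<rho>" "lift_classes M' \<rho> \<subseteq> \<rho>" by (auto simp: lift_classes_def)
        then show ?thesis
          unfolding True[symmetric] coarsening_weight_def using gram_entry'_same[OF finr] \<rho>(2) by simp
      next
        case False
        then show ?thesis by (simp add: gram_entry'_def)
      qed
    qed
    then show ?thesis using fin_ref by (simp add: sum.delta)
  qed
  have "(\<Sum>i\<in>J k s. \<Sum>j\<in>J k s. of_bool (coarsens k d i) * gram_entry' s i j * of_bool (coarsens k e j)) =
      (\<Sum>i\<in>J k s. of_bool (coarsens k d i) * (\<Sum>j\<in>J k s. of_bool (coarsens k e j) * gram_entry' s i j))"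
    by (simp add: sum_distrib_left mult_ac)
  also have "\<dots> = (\<Sum>\<rho> | ?ref \<pi> \<rho>. if card (lift_classes M \<rho>) = s
      then (if ?ref \<pi>' \<rho> then coarsening_weight ?y s M M' \<rho> else 0) else 0)"
    unfolding dM eM sum_coarsens[OF s] using inner by (intro sum.cong refl) auto
  \<comment> \<open>Common coarsenings of both partitions are the coarsenings of the join, and the
    condition on the surviving classes is already contained in
    \<open>coarsening_weight\<close>.\<close>
  also have "\<dots> = (\<Sum>\<rho> | ?ref \<sigma> \<rho>. coarsening_weight ?y s M M' \<rho>)"
    using fin_ref join(5) by (intro sum.mono_neutral_cong_right) (auto simp: coarsening_weight_def)
  also have "\<dots> = (\<Sum>R | partition_on \<sigma> R. partition_weight ?y s (lift_classes M \<sigma>) (lift_classes M' \<sigma>) R)"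
  proof (rule sum_coarsening_weight_eq[OF join(1)])
    show "{} \<notin> M" "{} \<notin> M'"
      using \<pi>(2) \<pi>'(2) partition_onD3[OF \<pi>(1)] partition_onD3[OF \<pi>'(1)] by auto
    show "\<exists>C\<in>\<sigma>. B \<subseteq> C" if "B \<in> M" for B
      using that \<pi>(2) join(2) unfolding refines_def by blast
    show "\<exists>C\<in>\<sigma>. B \<subseteq> C" if "B \<in> M'" for B
      using that \<pi>'(2) join(3) unfolding refines_def by blast
  qed
  also have "\<dots> = (if card (lift_classes M \<sigma> \<inter> lift_classes M' \<sigma>) = s
      then (?y + of_nat s) ^ card (\<sigma> - (lift_classes M \<sigma> \<union> lift_classes M' \<sigma>)) else 0)"
  proof (rule sum_partition_weight_eq)
    show "finite \<sigma>" using join(1) finite_elements by blast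
    show "lift_classes M \<sigma> \<subseteq> \<sigma>" "lift_classes M' \<sigma> \<subseteq> \<sigma>" by (auto simp: lift_classes_def)
    have fin: "finite M" "finite M'"
      using \<pi> \<pi>' finite_elements finite_subset by (metis finite_atLeastAtMost)+
    have "{} \<notin> M" "{} \<notin> M'"
      using \<pi>(2) \<pi>'(2) partition_onD3[OF \<pi>(1)] partition_onD3[OF \<pi>'(1)] by auto
    then show "card (lift_classes M \<sigma>) \<le> s" "card (lift_classes M' \<sigma>) \<le> s"
      using card_lift_classes_le[OF join(1) fin(1)] card_lift_classes_le[OF join(1) fin(2)] \<pi>(3) \<pi>'(3)
      by auto
  qed
  also have "\<dots> = gram_entry k s d e"
    unfolding dM eM gram_entry_join[OF \<pi>(1,2) \<pi>'(1,2) \<sigma>_def] by simp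
  finally show ?thesis .
qed

lemma sum_nth_eq:
  assumes "distinct xs" "set xs = A"
  shows "(\<Sum>i = 0..<length xs. f (xs ! i)) = (\<Sum>x\<in>A. f x)"
  using sum.reindex_bij_betw[OF bij_betw_nth[OF assms(1) refl assms(2)[symmetric]], of f]
  by (simp add: atLeast0LessThan)

theorem gram_matrix_congruent:
  assumes s: "s \<le> k" and js: "distinct js" "set js = J k s"
  shows "\<exists>P \<in> carrier_mat (length js) (length js). invertible_mat P \<and>
    transpose_mat P * gram_matrix k s js * P = gram_matrix' s js"
proof -
  define n where "n = length js"
  define Z :: "complex poly mat" where
    "Z = mat n n (\<lambda>(i, j). of_bool (coarsens k (js ! j) (js ! i)))"
  let ?G = "gram_matrix k s js" and ?G' = "gram_matrix' s js"
  have Z: "Z \<in> carrier_mat n n" and G': "?G' \<in> carrier_mat n n" and G: "?G \<in> carrier_mat n n"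
    by (simp_all add: Z_def gram_matrix'_def gram_matrix_def n_def)
  have mem: "js ! i \<in> J k s" if "i < n" for i
    using that js(2) nth_mem[of i js] by (simp add: n_def)
  have "det Z = 1"
  proof (rule det_unitriangular[OF Z, where f = "\<lambda>i. card (fst (js ! i))"])
    fix i assume "i < n"
    then show "Z $$ (i, i) = 1" using coarsens_refl[OF s mem] by (simp add: Z_def)
  next
    fix i j assume *: "i < n" "j < n" "i \<noteq> j" "Z $$ (i, j) \<noteq> 0"
    then have "coarsens k (js ! j) (js ! i)" by (simp add: Z_def)
    moreover have "js ! i \<noteq> js ! j" using * js(1) by (simp add: n_def nth_eq_iff_index_eq)
    ultimately show "card (fst (js ! i)) < card (fst (js ! j))"
      using coarsens_card_less[OF s mem mem] * by blast
  qed
  have one: "(1 :: complex poly) \<cdot>\<^sub>m 1\<^sub>m n = 1\<^sub>m n"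
    by (rule eq_matI) auto
  \<comment> \<open>Since \<open>det Z = 1\<close>, the adjugate is the inverse of Z and again has
    polynomial entries.\<close>
  define P where "P = adj_mat Z"
  have P: "P \<in> carrier_mat n n" and ZP: "Z * P = 1\<^sub>m n" and PZ: "P * Z = 1\<^sub>m n"
    using adj_mat[OF Z] \<open>det Z = 1\<close> one by (simp_all add: P_def)
  have inv: "invertible_mat P"
    using P Z ZP PZ by (auto simp: invertible_mat_def inverts_mat_def square_mat.simps)
  have "?G = transpose_mat Z * (?G' * Z)"
  proof (rule eq_matI)
    show "dim_row ?G = dim_row (transpose_mat Z * (?G' * Z))" "dim_col ?G = dim_col (transpose_mat Z * (?G' * Z))"
      using G G' Z by simp_all
    fix a b assume "a < dim_row (transpose_mat Z * (?G' * Z))" "b < dim_col (transpose_mat Z * (?G' * Z))"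
    then have ab: "a < n" "b < n" using Z by simp_all
    have "(transpose_mat Z * (?G' * Z)) $$ (a, b) = (\<Sum>i = 0..<n. Z $$ (i, a) * (\<Sum>j = 0..<n. ?G' $$ (i, j) * Z $$ (j, b)))"
      using ab Z G' by (simp add: scalar_prod_def)
    also have "\<dots> = (\<Sum>i = 0..<n. \<Sum>j = 0..<n. of_bool (coarsens k (js ! a) (js ! i)) *
        gram_entry' s (js ! i) (js ! j) * of_bool (coarsens k (js ! b) (js ! j)))"
      unfolding sum_distrib_left using ab
      by (intro sum.cong refl) (simp add: Z_def gram_matrix'_def n_def mult.assoc)
    also have "\<dots> = (\<Sum>i\<in>J k s. \<Sum>j\<in>J k s. of_bool (coarsens k (js ! a) i) *
        gram_entry' s i j * of_bool (coarsens k (js ! b) j))"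
      unfolding n_def
      by (subst sum_nth_eq[OF js, of "\<lambda>i. \<Sum>j = 0..<length js. of_bool (coarsens k (js ! a) i) *
          gram_entry' s i (js ! j) * of_bool (coarsens k (js ! b) (js ! j))"])
        (intro sum.cong refl sum_nth_eq[OF js])
    also have "\<dots> = ?G $$ (a, b)"
      using ab by (simp add: gram_entry_congruence[OF s mem mem] gram_matrix_def n_def)
    finally show "?G $$ (a, b) = (transpose_mat Z * (?G' * Z)) $$ (a, b)" by simp
  qed
  then have "transpose_mat P * ?G * P = transpose_mat P * (transpose_mat Z * (?G' * Z)) * P"
    by simp
  also have "\<dots> = (transpose_mat P * transpose_mat Z) * ?G' * (Z * P)"
  proof -
    have PT: "transpose_mat P \<in> carrier_mat n n" and ZT: "transpose_mat Z \<in> carrier_mat n n"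
      using P Z by simp_all
    have GZ: "?G' * Z \<in> carrier_mat n n" using G' Z by simp
    have "transpose_mat P * (transpose_mat Z * (?G' * Z)) = (transpose_mat P * transpose_mat Z * ?G') * Z"
      using assoc_mult_mat[OF PT ZT GZ] assoc_mult_mat[OF mult_carrier_mat[OF PT ZT] G' Z] by simp
    moreover have "transpose_mat P * transpose_mat Z * ?G' * Z * P = transpose_mat P * transpose_mat Z * ?G' * (Z * P)"
      by (rule assoc_mult_mat[OF mult_carrier_mat[OF mult_carrier_mat[OF PT ZT] G'] Z P])
    ultimately show ?thesis by simp
  qed
  also have "transpose_mat P * transpose_mat Z = 1\<^sub>m n"
    using transpose_mult[OF Z P] ZP by simp
  also have "1\<^sub>m n * ?G' * (Z * P) = ?G'"
    unfolding ZP using G' by simp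
  finally show ?thesis
    using P inv unfolding n_def by blast
qed

section \<open>The spectrum\<close>

lemma emb_0 [simp]: "emb 0 = 0"
  by (simp add: emb_def fract_collapse)

lemma emb_1 [simp]: "emb 1 = 1"
  by (simp add: emb_def fract_collapse)

lemma emb_add: "emb (p + q) = emb p + emb q"
  by (simp add: emb_def to_ac_add[symmetric])

lemma emb_mult: "emb (p * q) = emb p * emb q"
  by (simp add: emb_def to_ac_mult[symmetric])

lemma emb_diff: "emb (p - q) = emb p - emb q"
  using emb_add[of "p - q" q] by (simp add: algebra_simps)

lemma emb_of_nat [simp]: "emb (of_nat m) = of_nat m"
  by (induction m) (simp_all add: emb_add)

lemma emb_sum: "emb (sum f A) = (\<Sum>x\<in>A. emb (f x))"
  by (induction A rule: infinite_finite_induct) (simp_all add: emb_add)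

text \<open>The recursion uses ring operations only, so it commutes with the passage to the
  algebraic closure.\<close>

lemma emb_johnson_eig: "emb (johnson_eig l s r w) = johnson_eig l s r (\<lambda>t. emb (w t))"
  by (induction l arbitrary: s r w) (simp_all add: emb_sum emb_mult emb_diff del: of_nat_mult)

lemma johnson_vec_eq_1:
  "(\<And>p. p \<in> set ps \<Longrightarrow> fst p \<in> M \<and> snd p \<notin> M) \<Longrightarrow> johnson_vec ps M = (1 :: 'b::comm_ring_1)"
proof (induction ps)
  case (Cons p ps)
  have "johnson_vec ps M = (1 :: 'b)"
    using Cons.prems by (intro Cons.IH) auto
  moreover have "fst p \<in> M" "snd p \<notin> M"
    using Cons.prems[of p] by auto
  ultimately show ?case by (cases p) simp
qed simp

text \<open>Ensures that the eigenvectors are nonzero: M contains the first point of each pair, none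
  of the second points, and s - l points outside the pairs. Since l \<le> s and l \<le> r, the s + r
  points suffice for this.\<close>

lemma ex_johnson_vec:
  assumes fin: "finite \<Omega>" and card: "card \<Omega> = s + r" and l: "l \<le> s" "l \<le> r"
  shows "\<exists>ps M. length ps = l \<and> distinct (map fst ps @ map snd ps) \<and>
    fst ` set ps \<union> snd ` set ps \<subseteq> \<Omega> \<and> M \<in> subsets_of_card \<Omega> s \<and> johnson_vec ps M = (1 :: 'b::comm_ring_1)"
proof -
  obtain xs where xs: "set xs = \<Omega>" "distinct xs" using finite_distinct_list[OF fin] by blast
  have len: "length xs = s + r" using distinct_card[OF xs(2)] xs(1) card by simp
  define as where "as = take l xs"
  define bs where "bs = take l (drop l xs)"
  define cs where "cs = take (s - l) (drop (2 * l) xs)"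
  define ds where "ds = drop (s - l) (drop (2 * l) xs)"
  define ps where "ps = zip as bs"
  have "drop l xs = bs @ drop (2 * l) xs"
    unfolding bs_def by (metis append_take_drop_id drop_drop mult_2)
  then have split: "xs = as @ bs @ cs @ ds"
    unfolding as_def cs_def ds_def by (metis append_take_drop_id)
  have lens: "length as = l" "length bs = l" "length cs = s - l"
    using len l by (simp_all add: as_def bs_def cs_def)
  have maps: "map fst ps = as" "map snd ps = bs"
    using lens by (simp_all add: ps_def)
  have dist: "distinct (as @ bs @ cs @ ds)" using xs(2) unfolding split .
  let ?M = "set as \<union> set cs"
  have "card ?M = s"
    using dist lens l distinct_card[of "as @ cs"] by auto
  moreover have "?M \<subseteq> \<Omega>" using xs(1) unfolding split by auto
  moreover have "johnson_vec ps ?M = (1 :: 'b)"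
  proof (rule johnson_vec_eq_1)
    fix p assume "p \<in> set ps"
    then have "fst p \<in> set as" "snd p \<in> set bs"
      unfolding maps[symmetric] by auto
    then show "fst p \<in> ?M \<and> snd p \<notin> ?M" using dist by auto
  qed
  moreover have "fst ` set ps \<union> snd ` set ps \<subseteq> \<Omega>"
  proof -
    have "fst ` set ps = set as" "snd ` set ps = set bs"
      unfolding maps[symmetric] by simp_all
    then show ?thesis using xs(1) unfolding split by auto
  qed
  moreover have "length ps = l" using lens by (simp add: ps_def)
  moreover have "distinct (map fst ps @ map snd ps)" unfolding maps using dist by auto
  ultimately show ?thesis
    by (intro exI[of _ ps] exI[of _ ?M]) (simp add: subsets_of_card_def)
qed

text \<open>Replaces vectors over list positions by functions on the index set, so that the
  eigenvector equation can be restricted to diagrams with a fixed partition.\<close>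

lemma eigenvalue_nth_iff:
  fixes g :: "'d \<Rightarrow> 'd \<Rightarrow> 'b::comm_ring_1"
  assumes js: "distinct js" "set js = A"
  shows "eigenvalue (mat (length js) (length js) (\<lambda>(i, j). g (js ! i) (js ! j))) c \<longleftrightarrow>
    (\<exists>u. (\<exists>d\<in>A. u d \<noteq> 0) \<and> (\<forall>d\<in>A. (\<Sum>e\<in>A. g d e * u e) = c * u d))"
    (is "eigenvalue ?A c \<longleftrightarrow> ?R")
proof -
  have apply_vec: "(?A *\<^sub>v vec (length js) (\<lambda>i. u (js ! i))) $ i = (\<Sum>e\<in>A. g (js ! i) e * u e)"
    if "i < length js" for u i
    using that sum_nth_eq[OF js, of "\<lambda>e. g (js ! i) e * u e"] by (simp add: scalar_prod_def)
  have ball: "(\<forall>d\<in>A. Q d) \<longleftrightarrow> (\<forall>i<length js. Q (js ! i))" for Q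
    using js(2) by (metis in_set_conv_nth)
  have iff: "eigenvector ?A (vec (length js) (\<lambda>i. u (js ! i))) c \<longleftrightarrow>
      (\<exists>d\<in>A. u d \<noteq> 0) \<and> (\<forall>d\<in>A. (\<Sum>e\<in>A. g d e * u e) = c * u d)" for u
  proof -
    have "vec (length js) (\<lambda>i. u (js ! i)) \<noteq> 0\<^sub>v (length js) \<longleftrightarrow> \<not> (\<forall>d\<in>A. u d = 0)"
      unfolding ball by (auto simp: vec_eq_iff)
    moreover have "?A *\<^sub>v vec (length js) (\<lambda>i. u (js ! i)) = c \<cdot>\<^sub>v vec (length js) (\<lambda>i. u (js ! i)) \<longleftrightarrow>
        (\<forall>d\<in>A. (\<Sum>e\<in>A. g d e * u e) = c * u d)"
      unfolding ball by (simp add: vec_eq_iff apply_vec del: index_mult_mat_vec)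
    ultimately show ?thesis
      by (simp add: eigenvector_def)
  qed
  show ?thesis
  proof
    assume "eigenvalue ?A c"
    then obtain v where v: "eigenvector ?A v c" by (auto simp: eigenvalue_def)
    then have dim: "dim_vec v = length js" by (auto simp: eigenvector_def)
    \<comment> \<open>The list is distinct, so an entry of v can be addressed by the diagram at its
      position.\<close>
    define u where "u d = v $ (the_inv_into {..<length js} ((!) js) d)" for d
    have "u (js ! i) = v $ i" if "i < length js" for i
      unfolding u_def using that js(1)
      by (subst the_inv_into_f_f) (auto intro: inj_on_nth)
    then have "vec (length js) (\<lambda>i. u (js ! i)) = v"
      using dim by (auto simp: vec_eq_iff)
    then show ?R using iff[of u] v by auto
  next
    assume ?R
    then show "eigenvalue ?A c" using iff by (auto simp: eigenvalue_def)
  qed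
qed

text \<open>G' is a direct sum with one Johnson block for each partition, and the block depends on
  its partition only through r. Hence r contributes exactly when \<open>JJ k s r\<close> is
  inhabited.\<close>

theorem spectrum_gram_matrix':
  assumes s: "s \<le> k" and js: "distinct js" "set js = J k s"
  shows "spectrum (map_mat emb (gram_matrix' s js)) =
    {emb (gram_eig s r l) | r l. r \<le> k - s \<and> JJ k s r \<noteq> {} \<and> l \<le> min s r}"
    (is "_ = ?S")
proof -
  let ?w = "\<lambda>r t. emb (gram_weight (X_var - of_nat s) r t)"
  let ?g = "\<lambda>d e. emb (gram_entry' s d e)"
  have mat: "map_mat emb (gram_matrix' s js) = mat (length js) (length js) (\<lambda>(i, j). ?g (js ! i) (js ! j))"
    by (rule eq_matI) (auto simp: gram_matrix'_def)
  have eig: "emb (gram_eig s r l) = johnson_eig l s r (?w r)" if "l \<le> min s r" for r l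
    using that by (simp add: gram_eig_eq_johnson_eig emb_johnson_eig)
  \<comment> \<open>A row of G' sees only diagrams with the same partition, so it acts as
    \<open>johnson_op\<close> on the subsets of \<pi>.\<close>
  have row: "(\<Sum>e\<in>J k s. ?g (\<pi>, M) e * u e) = johnson_op (?w (card \<pi> - s)) \<pi> s (\<lambda>M'. u (\<pi>, M')) M"
    if d: "(\<pi>, M) \<in> J k s" for \<pi> M and u :: "sdiagram \<Rightarrow> complex poly fract alg_closure"
  proof -
    have \<pi>: "partition_on {1..k} \<pi>" "M \<subseteq> \<pi>" "card M = s" using d by (auto simp: J_iff[OF s])
    have fin: "finite \<pi>" using \<pi>(1) finite_elements by blast
    have "(\<Sum>e\<in>J k s. ?g (\<pi>, M) e * u e) = (\<Sum>e\<in>{e \<in> J k s. fst e = \<pi>}. ?g (\<pi>, M) e * u e)"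
    proof (intro sum.mono_neutral_right ballI)
      fix e assume "e \<in> J k s - {e \<in> J k s. fst e = \<pi>}"
      then show "?g (\<pi>, M) e * u e = 0" by (cases e) (auto simp: gram_entry'_def)
    qed (use finite_J[OF s] in auto)
    also have "\<dots> = (\<Sum>M'\<in>subsets_of_card \<pi> s. ?w (card \<pi> - s) (card (M - M')) * u (\<pi>, M'))"
    proof (rule sum.reindex_bij_witness[where i = "\<lambda>M'. (\<pi>, M')" and j = snd])
      fix e assume e: "e \<in> {e \<in> J k s. fst e = \<pi>}"
      obtain M' where eM: "e = (\<pi>, M')" using e by (cases e) auto
      have M': "M' \<subseteq> \<pi>" "card M' = s" using e eM by (auto simp: J_iff[OF s])
      show "(\<pi>, snd e) = e" "snd e \<in> subsets_of_card \<pi> s"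
        using eM M' by (simp_all add: subsets_of_card_def)
      show "?w (card \<pi> - s) (card (M - snd e)) * u (\<pi>, snd e) = ?g (\<pi>, M) e * u e"
        using gram_entry'_same[OF fin \<pi>(2) M'(1) \<pi>(3) M'(2)] by (simp add: eM)
    next
      fix M' assume "M' \<in> subsets_of_card \<pi> s"
      then show "(\<pi>, M') \<in> {e \<in> J k s. fst e = \<pi>}"
        using \<pi>(1) by (simp add: subsets_of_card_def J_iff[OF s])
    qed simp
    finally show ?thesis by (simp add: johnson_op_def)
  qed
  have JJD: "finite \<pi>" "card \<pi> = s + (card \<pi> - s)" if d: "(\<pi>, M) \<in> J k s" for \<pi> M
  proof -
    have \<pi>: "partition_on {1..k} \<pi>" "M \<subseteq> \<pi>" "card M = s" using d by (auto simp: J_iff[OF s])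
    show "finite \<pi>" using \<pi>(1) finite_elements by blast
    then show "card \<pi> = s + (card \<pi> - s)" using card_mono[of \<pi> M] \<pi> by simp
  qed
  show ?thesis
  proof (intro equalityI subsetI)
    fix c assume "c \<in> spectrum (map_mat emb (gram_matrix' s js))"
    then have "eigenvalue (mat (length js) (length js) (\<lambda>(i, j). ?g (js ! i) (js ! j))) c"
      unfolding spectrum_def mat by (rule CollectD)
    then obtain u d where u: "d \<in> J k s" "u d \<noteq> 0" "\<forall>d\<in>J k s. (\<Sum>e\<in>J k s. ?g d e * u e) = c * u d"
      unfolding eigenvalue_nth_iff[OF js, of ?g c] by blast
    obtain \<pi> M where d: "d = (\<pi>, M)" by fastforce
    have dJ: "(\<pi>, M) \<in> J k s" using u(1) d by simp
    have \<pi>: "partition_on {1..k} \<pi>" "M \<subseteq> \<pi>" "card M = s" using dJ by (auto simp: J_iff[OF s])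
    define r where "r = card \<pi> - s"
    \<comment> \<open>The eigenvector is restricted to a partition on which it does not vanish;
      there it is an eigenvector of a single Johnson block.\<close>
    have "johnson_op (?w r) \<pi> s (\<lambda>M'. u (\<pi>, M')) M' = c * u (\<pi>, M')" if "M' \<in> subsets_of_card \<pi> s" for M'
    proof -
      have "(\<pi>, M') \<in> J k s" using that \<pi>(1) by (simp add: subsets_of_card_def J_iff[OF s])
      then show ?thesis using row[of \<pi> M' u] u(3) by (simp add: r_def)
    qed
    then have "\<exists>l\<le>min s r. c = johnson_eig l s r (?w r)"
      using JJD[OF dJ] \<pi> u(2) unfolding d r_def
      by (intro johnson_op_eigenvalue[of \<pi> s _ _ _ _ M]) (auto simp: subsets_of_card_def)
    then obtain l where l: "l \<le> min s r" "c = emb (gram_eig s r l)" using eig by auto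
    have "(\<pi>, M) \<in> JJ k s r" using \<pi> JJD[OF dJ] by (simp add: JJ_iff r_def)
    moreover have "r \<le> k - s"
      using partition_on_card_le[OF _ \<pi>(1)] by (simp add: r_def diff_le_mono)
    ultimately show "c \<in> ?S" using l by blast
  next
    fix c assume "c \<in> ?S"
    then obtain r l where rl: "r \<le> k - s" "JJ k s r \<noteq> {}" "l \<le> min s r" "c = emb (gram_eig s r l)" by blast
    then obtain \<pi> M where "(\<pi>, M) \<in> JJ k s r" by (metis all_not_in_conv surj_pair)
    then have \<pi>: "partition_on {1..k} \<pi>" "card \<pi> = s + r" by (auto simp: JJ_iff)
    have fin: "finite \<pi>" using \<pi>(1) finite_elements by blast
    obtain ps M\<^sub>0 where ps: "length ps = l" "distinct (map fst ps @ map snd ps)"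
      "fst ` set ps \<union> snd ` set ps \<subseteq> \<pi>" "M\<^sub>0 \<in> subsets_of_card \<pi> s"
      "johnson_vec ps M\<^sub>0 = (1 :: complex poly fract alg_closure)"
      using ex_johnson_vec[OF fin \<pi>(2), of l] rl(3) by auto
    \<comment> \<open>A Johnson eigenvector of one block, extended by 0 to all other
      partitions.\<close>
    define u :: "sdiagram \<Rightarrow> complex poly fract alg_closure" where
      "u e = (if fst e = \<pi> then johnson_vec ps (snd e) else 0)" for e
    have "(\<Sum>e\<in>J k s. ?g d e * u e) = c * u d" if d: "d \<in> J k s" for d
    proof -
      obtain \<rho> M where dM: "d = (\<rho>, M)" by fastforce
      have *: "(\<Sum>e\<in>J k s. ?g d e * u e) = johnson_op (?w (card \<rho> - s)) \<rho> s (\<lambda>M'. u (\<rho>, M')) M"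
        using row d unfolding dM by simp
      show ?thesis
      proof (cases "\<rho> = \<pi>")
        case False
        then show ?thesis unfolding * by (simp add: johnson_op_def u_def dM)
      next
        case True
        have "M \<in> subsets_of_card \<pi> s"
          using d unfolding dM True by (simp add: J_iff[OF s] subsets_of_card_def)
        then have "johnson_op (?w r) \<pi> s (johnson_vec ps) M = johnson_eig l s r (?w r) * johnson_vec ps M"
          using johnson_op_vec[OF fin \<pi>(2), of ps M "?w r"] ps rl(3) by simp
        then show ?thesis
          unfolding * using \<pi>(2) rl(3,4) eig by (simp add: True dM u_def)
      qed
    qed
    moreover have "(\<pi>, M\<^sub>0) \<in> J k s" "u (\<pi>, M\<^sub>0) \<noteq> 0"
      using \<pi>(1) ps(4,5) by (simp_all add: J_iff[OF s] subsets_of_card_def u_def)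
    ultimately have "eigenvalue (mat (length js) (length js) (\<lambda>(i, j). ?g (js ! i) (js ! j))) c"
      unfolding eigenvalue_nth_iff[OF js, of ?g c] by blast
    then show "c \<in> spectrum (map_mat emb (gram_matrix' s js))"
      unfolding spectrum_def mat by (rule CollectI)
  qed
qed

theorem theorem4p1:
  fixes k s :: nat and js :: "sdiagram list"
  assumes "s \<le> k"
    and "distinct js" and "set js = J k s"
  shows
    "(\<exists>P \<in> carrier_mat (length js) (length js). invertible_mat P \<and>
        transpose_mat P * gram_matrix k s js * P = gram_matrix' s js) \<and>
     spectrum (map_mat emb (gram_matrix' s js)) =
       {emb (gram_eig s r l) | r l. r \<le> k - s \<and> JJ k s r \<noteq> {} \<and> l \<le> min s r} \<and>
     (\<forall>r \<le> k - s. \<forall>l \<le> min s r.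
       (r \<le> s \<longrightarrow>
          gram_eig s r l =
            (\<Prod>i<l. X_var - of_int (int s - 1 + int i)) *
            (\<Prod>j<min s r - l. X_var - of_int (int (2 * s + j)))) \<and>
       gram_eig s r l =
         (\<Prod>i<l. X_var - of_int (int s - 1 + int i)) *
         (\<Prod>j<r - l. X_var - of_int (int (2 * s + j))))"
proof (intro conjI allI impI)
  show "\<exists>P \<in> carrier_mat (length js) (length js). invertible_mat P \<and>
      transpose_mat P * gram_matrix k s js * P = gram_matrix' s js"
    by (rule gram_matrix_congruent[OF assms])
  show "spectrum (map_mat emb (gram_matrix' s js)) =
      {emb (gram_eig s r l) | r l. r \<le> k - s \<and> JJ k s r \<noteq> {} \<and> l \<le> min s r}"
    by (rule spectrum_gram_matrix'[OF assms])
  fix r l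
  assume l: "l \<le> min s r"
  show factors: "gram_eig s r l = (\<Prod>i<l. X_var - of_int (int s - 1 + int i)) *
      (\<Prod>j<r - l. X_var - of_int (int (2 * s + j)))"
    using l by (rule gram_eig_factorization)
  assume "r \<le> s"
  then show "gram_eig s r l = (\<Prod>i<l. X_var - of_int (int s - 1 + int i)) *
      (\<Prod>j<min s r - l. X_var - of_int (int (2 * s + j)))"
    using factors by (simp only: min.absorb2)
qed

end
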